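(* Let $\chi_{1}=\mathbf{1}_{(-1,1)}$ be the characteristic function of the interval $(-1,1)$ on $\mathbb{R}$, and let \[ A_{\pi}(\chi_{1})_{1,0}=\inf_{F\in\mathcal{E}_{\pi,1,0}}\int_{\mathbb{R}}|\chi_{1}(x)-F(x)|\,dx. \] Then \[ A_{\pi}(\chi_{1})_{1,0}=2-\frac{4v_0}{\pi}, \] where $v_0$ is the unique root of the equation \[ \cos v=\frac{2\pi v}{v^2+\pi^2},\quad 0<v<\frac{\pi}{2}. \]
   Context: $\mathcal{E}_{\pi,1,0}$ denotes the class of entire functions $F:\mathbb{C}\to\mathbb{C}$ of exponential type at most $\pi$ whose restriction to $\mathbb{R}$ lies in $L^{1}(\mathbb{R},dx)$. *)

theory Defs
  imports "HOL-Complex_Analysis.Complex_Analysis"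
begin

definition exponential_type_le :: "(complex \<Rightarrow> complex) \<Rightarrow> real \<Rightarrow> bool" where
  "exponential_type_le F \<tau> \<longleftrightarrow>
     (\<forall>\<epsilon>>0. \<exists>C. \<forall>z. norm (F z) \<le> C * exp ((\<tau> + \<epsilon>) * norm z))"

(* The class written E_{tau,1,0} in the paper. *)
definition exp_type_L1 :: "real \<Rightarrow> (complex \<Rightarrow> complex) set" where
  "exp_type_L1 \<tau> =
     {F. F holomorphic_on UNIV \<and> exponential_type_le F \<tau> \<and>
         integrable lborel (\<lambda>x::real. F (complex_of_real x))}"

(* The quantity written A_tau(f)_{1,0} in the paper. For integrable f, every integrand below is
   integrable, and the infimum is over a nonempty (F = 0) set of nonnegative reals, so neither
   the Bochner integral nor the real infimum takes a default value. *)
definition best_L1_approx :: "real \<Rightarrow> (real \<Rightarrow> complex) \<Rightarrow> real" where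
  "best_L1_approx \<tau> f =
     (INF F\<in>exp_type_L1 \<tau>. (LINT x|lborel. norm (f x - F (complex_of_real x))))"

end

theory Submission
  imports Defs "HOL-Real_Asymp.Real_Asymp" "HOL-Probability.Sinc_Integral"
begin

text \<open>
  The proof is by duality.  Let \<open>G x = (x\<^sup>2 - 1) cos (pi x) + 2 x sin (pi x)\<close>, which on the real line is
  \<open>(x\<^sup>2 + 1) Re (\<Theta> x)\<close> for the inner function \<open>\<Theta> z = exp (i pi z) (z - i) / (z + i)\<close>.

  The sign of \<open>G\<close> is orthogonal to every integrable \<open>F\<close> of exponential type \<open>pi\<close>
  (\<open>integral_sgn_Re_Theta_eq_0\<close>).  Indeed \<open>F \<Theta>\<^sup>n\<close> with \<open>n \<ge> 1\<close> extends to the closed upper half-plane,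
  where \<open>\<Theta>\<close> compensates the growth of \<open>F\<close>, so its integral over the real line vanishes
  (\<open>half_plane_integral_eq_0\<close>).  The same holds for conjugate powers, hence for odd polynomials in
  \<open>Re \<Theta>\<close>, and these approximate \<open>sgn (Re \<Theta>)\<close> boundedly.

  The function \<open>G\<close> has one zero \<open>y\<close> in \<open>(0, 1/2)\<close>, the next one is 1, and the equation for \<open>v = pi y\<close> is
  the stated one (\<open>root_equation_iff_G\<close>).  On \<open>(-1, 1)\<close> the sign of \<open>G\<close> is \<open>-1\<close> for \<open>\<bar>x\<bar> < y\<close> and \<open>1\<close> for
  \<open>\<bar>x\<bar> > y\<close>, so the integral of \<open>sgn G\<close> over \<open>(-1, 1)\<close> is \<open>2 - 4 y\<close>.  Orthogonality makes this a lower
  bound for every competitor (\<open>best_L1_lower\<close>).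

  Equality requires an \<open>F\<close> for which the characteristic function minus \<open>F\<close> changes sign exactly with
  \<open>G\<close>.  Interpolation at the zeros of \<open>G\<close>, together with integrability, leads to a multiple of
  \<open>G / ((x\<^sup>2 - y\<^sup>2) (x\<^sup>2 - 1))\<close>, normalised to be 1 at \<open>y\<close> (\<open>best_L1_attained\<close>).  Outside \<open>[-1, 1]\<close> its
  sign is evident.  Inside, the needed inequality compares \<open>G\<close> with a quadratic polynomial in \<open>s = x\<^sup>2\<close>
  (\<open>amp_G_le_quadratics\<close>) and rests on the nonnegativity of the third derivative of \<open>G\<close> with respect to
  \<open>s\<close>, which in turn is the positivity of the first spherical Bessel functions on \<open>(0, pi]\<close>.
\<close>

section \<open>Vanishing integrals over the boundary of a half-plane\<close>

lemma contour_integral_ray: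
  fixes d :: complex
  assumes R: "R > 0" and f: "continuous_on (closed_segment 0 (of_real R * d)) f"
  shows "contour_integral (linepath 0 (of_real R * d)) f =
    d * (LINT x:{0..R}|lborel. f (of_real x * d))"
proof -
  have seg: "of_real x * d \<in> closed_segment 0 (of_real R * d)" if "x \<in> {0..R}" for x
  proof -
    have "of_real x * d = (1 - x / R) *\<^sub>R 0 + (x / R) *\<^sub>R (of_real R * d)"
      using R by (simp add: scaleR_conv_of_real)
    then show ?thesis
      unfolding closed_segment_def using that R by (intro CollectI exI[of _ "x / R"]) auto
  qed
  have "continuous_on {0..R} (\<lambda>x. f (of_real x * d))"
    by (rule continuous_on_compose2[OF f]) (auto intro!: continuous_intros seg)
  then have int: "set_integrable lborel {0..R} (\<lambda>x. f (of_real x * d))"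
    by (rule borel_integrable_atLeastAtMost')
  then have "((\<lambda>x. f (of_real x * d)) has_integral (LINT x:{0..R}|lborel. f (of_real x * d))) {0..R}"
    using set_borel_integral_eq_integral by (metis has_integral_integral)
  then have "((\<lambda>z. f (z * d)) has_contour_integral (LINT x:{0..R}|lborel. f (of_real x * d)))
      (linepath 0 (of_real R))"
    using R by (subst has_contour_integral_linepath_Reals_iff) auto
  then have "((\<lambda>t. d * (f (linepath 0 (of_real R) t * d) * of_real R))
      has_integral d * (LINT x:{0..R}|lborel. f (of_real x * d))) {0..1}"
    by (subst (asm) has_contour_integral_linepath) (simp add: has_integral_mult_right)
  then have "(f has_contour_integral d * (LINT x:{0..R}|lborel. f (of_real x * d)))
      (linepath 0 (of_real R * d))"
    by (subst has_contour_integral_linepath) (simp add: linepath_def mult_ac scaleR_conv_of_real)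
  then show ?thesis
    by (rule contour_integral_unique)
qed

text \<open>
In the sector of half-angle \<open>pi/4\<close> around the positive axis the power \<open>w^(3/2)\<close> turns arguments
  by at most \<open>3pi/8\<close>, so its real part dominates \<open>|w|^(3/2)\<close>.  Hence \<open>exp (-w^(3/2))\<close> decays in a
  whole quadrant faster than any function of exponential type grows.
\<close>
lemma Re_csqrt_cubed_ge:
  assumes "\<bar>Im w\<bar> \<le> Re w"
  shows "Re (csqrt w ^ 3) \<ge> 2/5 * sqrt (Re w) ^ 3"
proof -
  define a b where "a = Re (csqrt w)" and "b = Im (csqrt w)"
  have a: "a \<ge> 0" unfolding a_def using csqrt_principal by (metis less_eq_real_def)
  have "csqrt w ^ 2 = w" by simp
  then have re: "Re w = a\<^sup>2 - b\<^sup>2" and im: "Im w = 2 * a * b"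
    unfolding a_def b_def by (metis Re_power2, metis Im_power2 )
  have ab: "(2 * a * b)\<^sup>2 \<le> (a\<^sup>2 - b\<^sup>2)\<^sup>2"
    using assms re im by (metis abs_le_square_iff abs_ge_self order_trans)
  have ge: "a\<^sup>2 \<ge> b\<^sup>2" using assms re by linarith
  \<comment> \<open>The sharp constant is \<open>3 + 2 sqrt 2 = cot (pi/8)^2\<close>; 5 is enough.\<close>
  have five: "5 * b\<^sup>2 \<le> a\<^sup>2"
  proof (rule ccontr)
    assume "\<not> ?thesis"
    then have *: "a\<^sup>2 < 5 * b\<^sup>2" by simp
    then have "b\<^sup>2 > 0" using ge by (smt (verit) zero_le_power2)
    have "(a\<^sup>2 - b\<^sup>2)\<^sup>2 - (2 * a * b)\<^sup>2 = (a\<^sup>2 - 5 * b\<^sup>2) * (a\<^sup>2 - b\<^sup>2) - 4 * b\<^sup>2 * b\<^sup>2"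
      by (simp add: power2_eq_square algebra_simps)
    moreover have "(a\<^sup>2 - 5 * b\<^sup>2) * (a\<^sup>2 - b\<^sup>2) \<le> 0"
      using * ge by (intro mult_nonpos_nonneg) auto
    moreover have "4 * b\<^sup>2 * b\<^sup>2 > 0" using \<open>b\<^sup>2 > 0\<close> by simp
    ultimately show False using ab by linarith
  qed
  have "Re (csqrt w ^ 3) = a * (a\<^sup>2 - 3 * b\<^sup>2)"
    unfolding a_def b_def by (simp add: power3_eq_cube power2_eq_square algebra_simps)
  also have "\<dots> \<ge> a * (2/5 * a\<^sup>2)"
    using five a by (intro mult_left_mono) auto
  moreover have "a * (2/5 * a\<^sup>2) = 2/5 * a ^ 3"
    by (simp add: power3_eq_cube power2_eq_square)
  moreover have "sqrt (Re w) \<le> a"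
    using re a by (intro real_le_lsqrt) auto
  then have "sqrt (Re w) ^ 3 \<le> a ^ 3"
    using assms by (intro power_mono) auto
  ultimately show ?thesis by simp
qed

lemma exp_quintic_beats_quartic:
  fixes c :: real
  assumes "c > 0"
  shows "((\<lambda>x. x^4 * exp (c * x ^ 4 - 2/5 * x ^ 5)) \<longlongrightarrow> 0) at_top"
  using assms by real_asymp

text \<open>
The half-axis \<open>[0, \<infinity>)\<close>, or \<open>(-\<infinity>, 0]\<close> when \<open>\<sigma> = -1\<close>, can be rotated to the positive imaginary
  axis.  Cauchy's theorem is applied on the triangle with corners \<open>0\<close>, \<open>\<sigma> R\<close>, \<open>i R\<close> to \<open>K\<close> times the
  regulariser \<open>u n\<close>, which has modulus at most 1 in the quadrant, tends to 1 pointwise, and beats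
  the exponential growth of \<open>K\<close> on the hypotenuse.  This replaces the usual appeal to the
  Phragmen-Lindelof principle: \<open>K\<close> need not be bounded inside the quadrant.
\<close>
lemma integral_rotate_quadrant:
  fixes K :: "complex \<Rightarrow> complex" and \<sigma> :: real
  assumes \<sigma>: "\<sigma> = 1 \<or> \<sigma> = -1"
    and hol: "K holomorphic_on {z. 0 \<le> Im z}"
    and growth: "\<And>z. 0 \<le> Im z \<Longrightarrow> norm (K z) \<le> C * exp (c * norm z)"
    and int_re: "set_integrable lborel {0..} (\<lambda>x. K (of_real x * of_real \<sigma>))"
    and int_im: "set_integrable lborel {0..} (\<lambda>y. K (of_real y * \<i>))"
  shows "of_real \<sigma> * (LINT x:{0..}|lborel. K (of_real x * of_real \<sigma>)) =
    \<i> * (LINT y:{0..}|lborel. K (of_real y * \<i>))"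
proof -
  define Q where "Q = {z. 0 \<le> \<sigma> * Re z \<and> 0 \<le> Im z}"
  have Qhalf: "Q \<subseteq> {z. 0 \<le> Im z}" by (auto simp: Q_def)
  have cnvQ: "convex Q"
  proof -
    have "Q = {z. inner (of_real \<sigma>) z \<ge> 0} \<inter> {z. inner \<i> z \<ge> 0}"
      by (auto simp: Q_def inner_complex_def)
    then show ?thesis by (simp only: convex_Int convex_halfspace_ge)
  qed
  \<comment> \<open>Multiplication by \<open>\<sigma> - i\<close> maps the quadrant onto the sector of \<open>Re_csqrt_cubed_ge\<close>; the summand 1 keeps the root holomorphic at the corner.\<close>
  define w where "w = (\<lambda>z. 1 + (of_real \<sigma> - \<i>) * z)"
  define u where "u = (\<lambda>n z. exp (- (csqrt (w z) ^ 3) / of_nat (Suc n)))"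
  have Re_w: "Re (w z) = 1 + \<sigma> * Re z + Im z" and Im_w: "\<bar>Im (w z)\<bar> \<le> Re (w z)" if "z \<in> Q" for z
    using that \<sigma> by (auto simp: w_def Q_def)
  have Re_w1: "Re (w z) \<ge> 1" if "z \<in> Q" for z
    using Re_w[OF that] that by (auto simp: Q_def)
  have norm_u: "norm (u n z) \<le> exp (- (2/5 * sqrt (Re (w z)) ^ 3) / Suc n)" if "z \<in> Q" for n z
  proof -
    have "Re (csqrt (w z) ^ 3) / Suc n \<ge> (2/5 * sqrt (Re (w z)) ^ 3) / Suc n"
      using Re_csqrt_cubed_ge[OF Im_w[OF that]] by (intro divide_right_mono) auto
    moreover have "Re (- (csqrt (w z) ^ 3) / of_nat (Suc n)) = - (Re (csqrt (w z) ^ 3) / Suc n)"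
      by (metis Re_divide_of_nat divide_minus_left uminus_complex.sel(1))
    ultimately show ?thesis unfolding u_def norm_exp_eq_Re by simp
  qed
  have norm_u1: "norm (u n z) \<le> 1" if "z \<in> Q" for n z
  proof -
    have "(2/5 * sqrt (Re (w z)) ^ 3) / Suc n \<ge> 0" using Re_w1[OF that] by simp
    then show ?thesis using norm_u[OF that, of n] by (smt (verit) one_le_exp_iff minus_divide_left exp_le_one_iff)
  qed
  have u_lim: "(\<lambda>n. u n z) \<longlonglongrightarrow> 1" for z
  proof -
    have "(\<lambda>n. - (csqrt (w z) ^ 3) / of_nat (Suc n)) \<longlonglongrightarrow> 0"
      using LIMSEQ_Suc[OF lim_const_over_n[of "- (csqrt (w z) ^ 3)"]] by simp
    then have "(\<lambda>n. u n z) \<longlonglongrightarrow> exp 0"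
      unfolding u_def by (intro tendsto_intros)
    then show ?thesis by simp
  qed
  have u_hol: "u n holomorphic_on Q" for n
  proof -
    have "w ` Q \<inter> \<real>\<^sub>\<le>\<^sub>0 = {}"
      using Re_w1 by (force simp: complex_nonpos_Reals_iff)
    then show ?thesis
      unfolding u_def w_def by (intro holomorphic_intros) (auto simp: w_def)
  qed
  define f where "f = (\<lambda>n z. K z * u n z)"
  have f_hol: "f n holomorphic_on Q" for n
    unfolding f_def using hol Qhalf u_hol by (intro holomorphic_intros) (auto intro: holomorphic_on_subset)
  \<comment> \<open>With \<open>R = m^4\<close> and \<open>m = n + 1\<close>, the exponent \<open>R^(3/2) / m = m^5\<close> of the regulariser outgrows every multiple of \<open>R\<close>.\<close>
  define R where "R = (\<lambda>n. real (Suc n) ^ 4)"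
  have Rpos: "R n > 0" for n by (simp add: R_def)
  define H where "H = (\<lambda>n. contour_integral (linepath (of_real (R n) * of_real \<sigma>) (of_real (R n) * \<i>)) (f n))"
  define X where "X = (\<lambda>n. LINT x:{0..R n}|lborel. f n (of_real x * of_real \<sigma>))"
  define Y where "Y = (\<lambda>n. LINT y:{0..R n}|lborel. f n (of_real y * \<i>))"
  have eq: "of_real \<sigma> * X n + H n - \<i> * Y n = 0" for n
  proof -
    let ?a = "of_real (R n) * of_real \<sigma> :: complex" and ?b = "of_real (R n) * \<i>"
    have hull: "convex hull {0, ?a, ?b} \<subseteq> Q"
      using \<sigma> Rpos[of n] by (intro hull_minimal cnvQ) (auto simp: Q_def)
    have cont: "continuous_on Q (f n)" by (rule holomorphic_on_imp_continuous_on[OF f_hol])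
    have segs: "closed_segment 0 ?a \<subseteq> Q" "closed_segment ?a ?b \<subseteq> Q" "closed_segment ?b 0 \<subseteq> Q"
       "closed_segment 0 ?b \<subseteq> Q"
      using \<sigma> Rpos[of n] by (intro closed_segment_subset cnvQ; auto simp: Q_def)+
    have "(f n has_contour_integral 0) (linepath 0 ?a +++ linepath ?a ?b +++ linepath ?b 0)"
      by (rule Cauchy_theorem_triangle) (rule holomorphic_on_subset[OF f_hol hull])
    moreover have "(f n has_contour_integral (contour_integral (linepath 0 ?a) (f n) +
        (contour_integral (linepath ?a ?b) (f n) + contour_integral (linepath ?b 0) (f n))))
        (linepath 0 ?a +++ linepath ?a ?b +++ linepath ?b 0)"
      using segs cont by (intro has_contour_integral_join has_contour_integral_integral
        contour_integrable_continuous_linepath) (auto intro: continuous_on_subset)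
    ultimately have "contour_integral (linepath 0 ?a) (f n) +
        (contour_integral (linepath ?a ?b) (f n) + contour_integral (linepath ?b 0) (f n)) = 0"
      using has_contour_integral_unique by blast
    moreover have "contour_integral (linepath 0 ?a) (f n) = of_real \<sigma> * X n"
      unfolding X_def using segs cont Rpos by (intro contour_integral_ray) (auto intro: continuous_on_subset)
    moreover have "contour_integral (linepath ?b 0) (f n) = - contour_integral (linepath 0 ?b) (f n)"
      using segs cont by (intro contour_integral_reverse_linepath) (auto intro: continuous_on_subset)
    moreover have "contour_integral (linepath 0 ?b) (f n) = \<i> * Y n"
      unfolding Y_def using segs cont Rpos by (intro contour_integral_ray) (auto intro: continuous_on_subset)
    ultimately show ?thesis unfolding H_def by (simp add: algebra_simps)
  qed
  have "H \<longlonglongrightarrow> 0"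
  proof (rule Lim_null_comparison)
    let ?c = "max c 1" and ?C = "max C 1"
    let ?B = "\<lambda>n. ?C * exp (?c * R n) * exp (- (2/5 * real (Suc n) ^ 6) / Suc n)"
    show "\<forall>\<^sub>F n in sequentially. norm (H n) \<le> ?B n * (2 * R n)"
    proof (rule always_eventually, rule allI)
      fix n
      let ?a = "of_real (R n) * of_real \<sigma> :: complex" and ?b = "of_real (R n) * \<i>"
      let ?S = "{z. 0 \<le> \<sigma> * Re z \<and> 0 \<le> Im z \<and> \<sigma> * Re z + Im z = R n}"
      have "convex ?S"
      proof -
        have "?S = {z. inner (of_real \<sigma>) z \<ge> 0} \<inter> {z. inner \<i> z \<ge> 0} \<inter> {z. inner (of_real \<sigma> + \<i>) z = R n}"
          by (auto simp: inner_complex_def)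
        then show ?thesis by (simp only: convex_Int convex_halfspace_ge convex_hyperplane)
      qed
      then have seg: "closed_segment ?a ?b \<subseteq> ?S"
        using \<sigma> Rpos[of n] by (intro closed_segment_subset) auto
      have SQ: "?S \<subseteq> Q" by (auto simp: Q_def)
      have contf: "continuous_on (closed_segment ?a ?b) (f n)"
        using holomorphic_on_imp_continuous_on[OF f_hol] seg SQ by (meson continuous_on_subset order_trans)
      have bd: "norm (f n z) \<le> ?B n" if "z \<in> closed_segment ?a ?b" for z
      proof -
        have zS: "z \<in> ?S" and zQ: "z \<in> Q" using that seg SQ by auto
        have "norm z \<le> \<bar>Re z\<bar> + \<bar>Im z\<bar>" by (rule cmod_le)
        also have "\<dots> = R n" using zS \<sigma> by auto
        finally have nz: "norm z \<le> R n" .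
        have "norm (K z) \<le> C * exp (c * norm z)" using growth zS by auto
        also have "\<dots> \<le> ?C * exp (?c * R n)"
          using nz by (intro mult_mono) (auto intro!: mult_mono)
        finally have K: "norm (K z) \<le> ?C * exp (?c * R n)" .
        have "Re (w z) = 1 + R n" using Re_w[OF zQ] zS by simp
        moreover have "sqrt (R n) = real (Suc n) ^ 2"
          by (rule real_sqrt_unique) (simp_all add: R_def flip: power_mult)
        moreover have "sqrt (R n) \<le> sqrt (1 + R n)" by simp
        ultimately have "sqrt (Re (w z)) \<ge> real (Suc n) ^ 2" by metis
        then have "sqrt (Re (w z)) ^ 3 \<ge> (real (Suc n) ^ 2) ^ 3" by (intro power_mono) auto
        then have "exp (- (2/5 * sqrt (Re (w z)) ^ 3) / Suc n) \<le> exp (- (2/5 * real (Suc n) ^ 6) / Suc n)"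
          by (auto simp: divide_right_mono simp flip: power_mult)
        with norm_u[OF zQ, of n] have U: "norm (u n z) \<le> exp (- (2/5 * real (Suc n) ^ 6) / Suc n)"
          by linarith
        show ?thesis unfolding f_def norm_mult using K U by (intro mult_mono) auto
      qed
      have "norm (H n) \<le> ?B n * norm (?b - ?a)"
        unfolding H_def using contf bd
        by (intro contour_integral_bound_linepath contour_integrable_continuous_linepath) auto
      also have "norm (?b - ?a) \<le> 2 * R n"
        using norm_triangle_ineq4[of ?b ?a] Rpos[of n] \<sigma> by (auto simp: norm_mult)
      finally show "norm (H n) \<le> ?B n * (2 * R n)" by (simp add: mult_left_mono)
    qed
    define c' C' where "c' = ?c" and "C' = ?C"
    have "c' > 0" "C' > 0" by (simp_all add: c'_def C'_def)
    have Suc_top: "filterlim (\<lambda>n. real (Suc n)) at_top sequentially"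
      by (rule filterlim_compose[OF filterlim_real_sequentially filterlim_Suc])
    have "(\<lambda>n. 2 * C' * (real (Suc n) ^ 4 * exp (c' * real (Suc n) ^ 4 - 2/5 * real (Suc n) ^ 5))) \<longlonglongrightarrow> 2 * C' * 0"
      by (intro tendsto_intros filterlim_compose[OF exp_quintic_beats_quartic[OF \<open>c' > 0\<close>] Suc_top])
    moreover have "?B n * (2 * R n) =
        2 * C' * (real (Suc n) ^ 4 * exp (c' * real (Suc n) ^ 4 - 2/5 * real (Suc n) ^ 5))" for n
    proof -
      have "- (2/5 * real (Suc n) ^ 6) / Suc n = - (2/5 * real (Suc n) ^ 5)"
        by (simp add: eval_nat_numeral del: of_nat_Suc)
      then have "exp (- (2/5 * real (Suc n) ^ 6) / Suc n) = exp (- (2/5 * real (Suc n) ^ 5))"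
        by (simp only:)
      moreover have "exp (c' * real (Suc n) ^ 4 - 2/5 * real (Suc n) ^ 5) =
          exp (c' * real (Suc n) ^ 4) * exp (- (2/5 * real (Suc n) ^ 5))"
        by (simp flip: exp_add)
      ultimately show ?thesis
        by (simp add: R_def c'_def C'_def mult_ac del: of_nat_Suc)
    qed
    ultimately show "(\<lambda>n. ?B n * (2 * R n)) \<longlonglongrightarrow> 0"
      unfolding mult_zero_right by (simp only:)
  qed
  have lim: "(\<lambda>n. LINT x:{0..R n}|lborel. f n (of_real x * d)) \<longlonglongrightarrow> (LINT x:{0..}|lborel. K (of_real x * d))"
    if int: "set_integrable lborel {0..} (\<lambda>x. K (of_real x * d))" and d: "d = of_real \<sigma> \<or> d = \<i>" for d
  proof -
    have inQ: "of_real x * d \<in> Q" if "x \<ge> 0" for x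
      using that d \<sigma> by (auto simp: Q_def)
    have Rinf: "filterlim R at_top sequentially" unfolding R_def by real_asymp
    show ?thesis unfolding set_lebesgue_integral_def
    proof (rule integral_dominated_convergence[where w="\<lambda>x. norm (indicator {0..} x *\<^sub>R K (of_real x * d))"])
      show "(\<lambda>x. indicator {0..} x *\<^sub>R K (of_real x * d)) \<in> borel_measurable lborel"
        using int unfolding set_integrable_def by (rule borel_measurable_integrable)
      show "(\<lambda>x. indicator {0..R n} x *\<^sub>R f n (of_real x * d)) \<in> borel_measurable lborel" for n
      proof -
        have "continuous_on {0..R n} (\<lambda>x. f n (of_real x * d))"
          by (rule continuous_on_compose2[OF holomorphic_on_imp_continuous_on[OF f_hol]])
            (auto intro!: continuous_intros inQ)
        from borel_integrable_atLeastAtMost'[OF this] show ?thesis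
          unfolding set_integrable_def by (rule borel_measurable_integrable)
      qed
      show "integrable lborel (\<lambda>x. norm (indicator {0..} x *\<^sub>R K (of_real x * d)))"
        using int unfolding set_integrable_def by (rule integrable_norm)
      show "AE x in lborel. norm (indicator {0..R n} x *\<^sub>R f n (of_real x * d)) \<le> norm (indicator {0..} x *\<^sub>R K (of_real x * d))" for n
        using norm_u1[OF inQ, of _ n] by (auto simp: f_def indicator_def norm_mult intro!: mult_left_le)
      show "AE x in lborel. (\<lambda>n. indicator {0..R n} x *\<^sub>R f n (of_real x * d)) \<longlonglongrightarrow> indicator {0..} x *\<^sub>R K (of_real x * d)"
      proof (rule AE_I2)
        fix x :: real
        have "\<forall>\<^sub>F n in sequentially. x \<le> R n" using Rinf by (simp add: filterlim_at_top)
        then have "\<forall>\<^sub>F n in sequentially. indicator {0..} x *\<^sub>R f n (of_real x * d) = indicator {0..R n} x *\<^sub>R f n (of_real x * d)"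
          by eventually_elim (auto simp: indicator_def)
        moreover have "(\<lambda>n. indicator {0..} x *\<^sub>R f n (of_real x * d)) \<longlonglongrightarrow> indicator {0..} x *\<^sub>R (K (of_real x * d) * 1)"
          unfolding f_def by (intro tendsto_intros u_lim)
        ultimately show "(\<lambda>n. indicator {0..R n} x *\<^sub>R f n (of_real x * d)) \<longlonglongrightarrow> indicator {0..} x *\<^sub>R K (of_real x * d)"
          by (metis (mono_tags) Lim_transform_eventually mult.right_neutral)
      qed
    qed
  qed
  have "X \<longlonglongrightarrow> (LINT x:{0..}|lborel. K (of_real x * of_real \<sigma>))"
    unfolding X_def using int_re by (rule lim) simp
  moreover have "Y \<longlonglongrightarrow> (LINT y:{0..}|lborel. K (of_real y * \<i>))"
    unfolding Y_def using int_im by (rule lim) simp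
  ultimately have "(\<lambda>n. of_real \<sigma> * X n + H n - \<i> * Y n) \<longlonglongrightarrow>
      of_real \<sigma> * (LINT x:{0..}|lborel. K (of_real x * of_real \<sigma>)) + 0
        - \<i> * (LINT y:{0..}|lborel. K (of_real y * \<i>))"
    using \<open>H \<longlonglongrightarrow> 0\<close> by (intro tendsto_intros)
  then show ?thesis unfolding eq by (simp add: LIMSEQ_const_iff)
qed

lemma LINT_split_at_0:
  fixes f :: "real \<Rightarrow> complex"
  assumes f: "integrable lborel f"
  shows "(LINT x|lborel. f x) = (LINT x:{0..}|lborel. f x) + (LINT x:{0..}|lborel. f (- x))"
proof -
  have int: "set_integrable lborel A f" if "A \<in> sets lborel" for A
    using f that unfolding set_integrable_def by (rule integrable_mult_indicator[rotated])
  have "(LINT x|lborel. f x) = (LINT x:{0..} \<union> {..<0}|lborel. f x)"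
  proof -
    have "{0..} \<union> {..<0} = (UNIV :: real set)" by auto
    then show ?thesis by (simp add: set_lebesgue_integral_def)
  qed
  also have "\<dots> = (LINT x:{0..}|lborel. f x) + (LINT x:{..<0}|lborel. f x)"
    by (rule set_integral_Un) (auto intro!: int)
  also have "(LINT x:{..<0}|lborel. f x) = (LINT x:{0<..}|lborel. f (- x))"
    unfolding set_lebesgue_integral_def
    by (subst lborel_integral_real_affine[where c="-1" and t=0])
      (auto simp: indicator_def intro!: Bochner_Integration.integral_cong)
  also have "\<dots> = (LINT x:{0..}|lborel. f (- x))"
  proof (rule set_integral_null_delta)
    show "integrable lborel (\<lambda>x. f (- x))"
      using lborel_integrable_real_affine[OF f, of "-1" 0] by simp
    have "{0<..} - {0..} \<union> ({0..} - {0<..}) = {0::real}" by auto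
    then show "{0<..} - {0..} \<union> ({0..} - {0<..}) \<in> null_sets (lborel :: real measure)"
      using finite_imp_null_set_lborel[of "{0::real}"] by simp
  qed auto
  finally show ?thesis .
qed

text \<open>
Rotating the two half-axes to the imaginary axis gives the same integral with opposite signs.
\<close>
lemma half_plane_integral_eq_0_if_integrable_on_axis:
  fixes K :: "complex \<Rightarrow> complex"
  assumes hol: "K holomorphic_on {z. 0 \<le> Im z}"
    and growth: "\<And>z. 0 \<le> Im z \<Longrightarrow> norm (K z) \<le> C * exp (c * norm z)"
    and int: "integrable lborel (\<lambda>x. K (of_real x))"
    and int_im: "set_integrable lborel {0..} (\<lambda>y. K (of_real y * \<i>))"
  shows "(LINT x|lborel. K (of_real x)) = 0"
proof -
  have "integrable lborel (\<lambda>x. K (of_real (- x)))"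
    using lborel_integrable_real_affine[OF int, of "-1" 0] by simp
  then have "set_integrable lborel {0..} (\<lambda>x. K (of_real x))"
    "set_integrable lborel {0..} (\<lambda>x. K (of_real (- x)))"
    using int unfolding set_integrable_def by (auto intro!: integrable_mult_indicator)
  then have "(LINT x:{0..}|lborel. K (of_real x)) = \<i> * (LINT y:{0..}|lborel. K (of_real y * \<i>))"
    "- (LINT x:{0..}|lborel. K (of_real (- x))) = \<i> * (LINT y:{0..}|lborel. K (of_real y * \<i>))"
    using integral_rotate_quadrant[OF _ hol growth _ int_im, of 1]
      integral_rotate_quadrant[OF _ hol growth _ int_im, of "-1"] by simp_all
  then show ?thesis
    using LINT_split_at_0[OF int] by (metis add.inverse_inverse add.right_inverse)
qed

lemma integrable_exp_decay:
  fixes a :: real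
  assumes "a > 0"
  shows "set_integrable lborel {0..} (\<lambda>y. exp (- (a * y)))"
proof -
  have "integrable lborel (\<lambda>x::real. indicator {0..} x *\<^sub>R (x ^ 0 * exp (- x)))"
    using has_bochner_integral_I0i_power_exp_m'[of 0] unfolding has_bochner_integral_iff by (simp add: mult_ac)
  from lborel_integrable_real_affine[OF this, of a 0] assms show ?thesis
    unfolding set_integrable_def by (auto simp: indicator_def zero_le_mult_iff cong: if_cong elim!: integrable_cong[THEN iffD1, rotated])
qed

text \<open>
Subexponential growth on the imaginary axis suffices: the factor \<open>exp (i z / (n + 1))\<close> makes the
  integral along that axis converge and disappears in the limit by dominated convergence.
\<close>
theorem half_plane_integral_eq_0:
  fixes K :: "complex \<Rightarrow> complex"
  assumes hol: "K holomorphic_on {z. 0 \<le> Im z}"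
    and growth: "\<And>z. 0 \<le> Im z \<Longrightarrow> norm (K z) \<le> C * exp (c * norm z)"
    and subexp: "\<And>\<epsilon>. \<epsilon> > 0 \<Longrightarrow> \<exists>B. \<forall>y\<ge>0. norm (K (of_real y * \<i>)) \<le> B * exp (\<epsilon> * y)"
    and int: "integrable lborel (\<lambda>x. K (of_real x))"
  shows "(LINT x|lborel. K (of_real x)) = 0"
proof -
  define e where "e = (\<lambda>n z. exp (\<i> * z / of_nat (Suc n)))"
  have norm_e: "norm (e n z) = exp (- (Im z / Suc n))" for n z
  proof -
    have "Re (\<i> * z / of_nat (Suc n)) = Re (\<i> * z) / Suc n" by (rule Re_divide_of_nat)
    then show ?thesis unfolding e_def norm_exp_eq_Re by simp
  qed
  have norm_e1: "norm (e n z) \<le> 1" if "0 \<le> Im z" for n z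
    using that unfolding norm_e by simp
  have meas[measurable]: "(\<lambda>x. e n (of_real x)) \<in> borel_measurable lborel" for n
    unfolding e_def by measurable
  have meas_K: "(\<lambda>x. K (of_real x)) \<in> borel_measurable lborel" using int by (rule borel_measurable_integrable)
  have zero: "(LINT x|lborel. K (of_real x) * e n (of_real x)) = 0" for n
  proof (rule half_plane_integral_eq_0_if_integrable_on_axis)
    show hol': "(\<lambda>z. K z * e n z) holomorphic_on {z. 0 \<le> Im z}"
      unfolding e_def by (intro holomorphic_intros hol) simp
    show "norm (K z * e n z) \<le> C * exp (c * norm z)" if "0 \<le> Im z" for z
      using growth[OF that] mult_left_le[OF norm_e1[OF that, of n], of "norm (K z)"]
      by (simp add: norm_mult)
    show "integrable lborel (\<lambda>x. K (of_real x) * e n (of_real x))"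
    proof (rule Bochner_Integration.integrable_bound[OF int])
      show "(\<lambda>x. K (of_real x) * e n (of_real x)) \<in> borel_measurable lborel"
        using meas_K meas by (rule borel_measurable_times)
    qed (auto simp: norm_mult intro!: mult_left_le norm_e1)
    obtain B where B: "\<And>y. y \<ge> 0 \<Longrightarrow> norm (K (of_real y * \<i>)) \<le> B * exp (1 / (2 * real (Suc n)) * y)"
      using subexp[of "1 / (2 * real (Suc n))"] by auto
    show "set_integrable lborel {0..} (\<lambda>y. K (of_real y * \<i>) * e n (of_real y * \<i>))"
      unfolding set_integrable_def
    proof (rule Bochner_Integration.integrable_bound)
      have "set_integrable lborel {0..} (\<lambda>y. exp (- (1 / (2 * real (Suc n)) * y)))"
        by (rule integrable_exp_decay) simp
      then show "integrable lborel (\<lambda>y. B * (indicator {0..} y *\<^sub>R exp (- (1 / (2 * real (Suc n)) * y))))"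
        unfolding set_integrable_def by (rule integrable_mult_right)
      have "continuous_on {0..} (\<lambda>y. K (of_real y * \<i>) * e n (of_real y * \<i>))"
        by (rule continuous_on_compose2[OF holomorphic_on_imp_continuous_on[OF hol']])
          (auto intro!: continuous_intros)
      then show "(\<lambda>y. indicator {0..} y *\<^sub>R (K (of_real y * \<i>) * e n (of_real y * \<i>))) \<in> borel_measurable lborel"
        by (simp add: borel_measurable_continuous_on_indicator)
      show "AE y in lborel. norm (indicator {0..} y *\<^sub>R (K (of_real y * \<i>) * e n (of_real y * \<i>)))
          \<le> norm (B * (indicator {0..} y *\<^sub>R exp (- (1 / (2 * real (Suc n)) * y))))"
      proof (rule AE_I2)
        fix y :: real
        show "norm (indicator {0..} y *\<^sub>R (K (of_real y * \<i>) * e n (of_real y * \<i>)))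
          \<le> norm (B * (indicator {0..} y *\<^sub>R exp (- (1 / (2 * real (Suc n)) * y))))"
        proof (cases "y \<ge> 0")
          case True
          have "norm (K (of_real y * \<i>) * e n (of_real y * \<i>)) \<le>
              B * exp (1 / (2 * real (Suc n)) * y) * exp (- (y / Suc n))"
            unfolding norm_mult norm_e using B[OF True] by (simp add: mult_right_mono)
          also have "\<dots> = B * exp (- (1 / (2 * real (Suc n)) * y))"
          proof -
            have "1 / (2 * real (Suc n)) * y + - (y / Suc n) = - (1 / (2 * real (Suc n)) * y)"
              by (simp add: divide_simps del: of_nat_Suc)
            then show ?thesis by (simp only: mult.assoc exp_add[symmetric])
          qed
          finally show ?thesis using True by simp
        qed simp
      qed
    qed
  qed
  have "(\<lambda>n. LINT x|lborel. K (of_real x) * e n (of_real x)) \<longlonglongrightarrow> (LINT x|lborel. K (of_real x))"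
  proof (rule integral_dominated_convergence[where w="\<lambda>x. norm (K (of_real x))"])
    show "(\<lambda>x. K (of_real x) * e n (of_real x)) \<in> borel_measurable lborel" for n
      using meas_K meas by (rule borel_measurable_times)
    show "AE x in lborel. (\<lambda>n. K (of_real x) * e n (of_real x)) \<longlonglongrightarrow> K (of_real x)"
    proof (rule AE_I2)
      fix x :: real
      have "(\<lambda>n. \<i> * of_real x / of_nat (Suc n)) \<longlonglongrightarrow> 0"
        using LIMSEQ_Suc[OF lim_const_over_n[of "\<i> * of_real x"]] by simp
      then have "(\<lambda>n. K (of_real x) * e n (of_real x)) \<longlonglongrightarrow> K (of_real x) * exp 0"
        unfolding e_def by (intro tendsto_intros)
      then show "(\<lambda>n. K (of_real x) * e n (of_real x)) \<longlonglongrightarrow> K (of_real x)" by simp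
    qed
  qed (use int meas_K norm_e1 in \<open>auto simp: norm_mult intro!: mult_left_le\<close>)
  then show ?thesis unfolding zero by (simp add: LIMSEQ_const_iff)
qed

section \<open>A sign function orthogonal to type pi\<close>

text \<open>
  An inner function of the upper half-plane: the exponential \<open>exp (i pi z)\<close> compensates type \<open>pi\<close>, and
  the Blaschke factor with zero at \<open>i\<close> moves the sign changes of \<open>Re \<Theta>\<close>.  The value \<open>i\<close> is forced by
  requiring an even sign pattern with a sign change at the jumps \<open>\<plusminus> 1\<close>.
\<close>
definition \<Theta> :: "complex \<Rightarrow> complex" where
  "\<Theta> z = exp (\<i> * pi * z) * ((z - \<i>) / (z + \<i>))"

lemma Theta_holomorphic: "\<Theta> holomorphic_on {z. 0 \<le> Im z}"
proof -
  have "z + \<i> \<noteq> 0" if "0 \<le> Im z" for z using that by (auto simp: complex_eq_iff)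
  then show ?thesis unfolding \<Theta>_def by (intro holomorphic_intros) auto
qed

lemma norm_Theta_le:
  assumes "0 \<le> Im z"
  shows "norm (\<Theta> z) \<le> exp (- (pi * Im z))"
proof -
  have "(norm (z - \<i>))\<^sup>2 \<le> (norm (z + \<i>))\<^sup>2"
    using assms unfolding cmod_power2 by (simp add: power2_eq_square algebra_simps)
  then have "norm (z - \<i>) \<le> norm (z + \<i>)" by (rule power2_le_imp_le) simp
  then have "norm ((z - \<i>) / (z + \<i>)) \<le> 1" by (simp add: norm_divide divide_le_eq_1)
  then show ?thesis unfolding \<Theta>_def norm_mult by (simp add: norm_exp_eq_Re mult_left_le)
qed

lemma norm_Theta_le_1: "0 \<le> Im z \<Longrightarrow> norm (\<Theta> z) \<le> 1"
  using norm_Theta_le[of z] by (smt (verit) mult_nonneg_nonneg one_le_exp_iff exp_le_one_iff pi_ge_zero)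

lemma norm_Theta_real: "norm (\<Theta> (of_real x)) = 1"
proof -
  have "norm (of_real x - \<i>) = norm (of_real x + \<i>)" by (simp add: cmod_def)
  moreover have "of_real x + \<i> \<noteq> 0" by (auto simp: complex_eq_iff)
  ultimately show ?thesis by (simp add: \<Theta>_def norm_mult norm_divide norm_exp_eq_Re)
qed

lemma Theta_measurable [measurable]: "(\<lambda>x. \<Theta> (complex_of_real x)) \<in> borel_measurable borel"
  unfolding \<Theta>_def by measurable

lemma cnj_Theta_measurable [measurable]: "(\<lambda>x. cnj (\<Theta> (complex_of_real x))) \<in> borel_measurable borel"
  by (rule measurable_compose[OF Theta_measurable])
    (intro borel_measurable_continuous_onI continuous_intros)

lemma integrable_mult_bounded:
  fixes f g :: "real \<Rightarrow> complex"
  assumes f: "integrable lborel f" and g: "g \<in> borel_measurable borel" and le: "\<And>x. norm (g x) \<le> 1"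
  shows "integrable lborel (\<lambda>x. f x * g x)"
proof (rule Bochner_Integration.integrable_bound[OF f])
  show "(\<lambda>x. f x * g x) \<in> borel_measurable lborel"
    using borel_measurable_integrable[OF f] g by simp
qed (auto simp: norm_mult intro!: mult_left_le le)

lemma integrable_exp_type_L1: "F \<in> exp_type_L1 \<tau> \<Longrightarrow> integrable lborel (\<lambda>x. F (of_real x))"
  by (simp add: exp_type_L1_def)

text \<open>
On the imaginary axis the decay \<open>exp (- pi y)\<close> of \<open>\<Theta>\<close> cancels the growth of \<open>F\<close> up to \<open>exp (\<epsilon> y)\<close>.
\<close>
lemma integral_Theta_power_eq_0:
  assumes F: "F \<in> exp_type_L1 pi" and n: "n \<ge> 1"
  shows "(LINT x|lborel. F (of_real x) * \<Theta> (of_real x) ^ n) = 0"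
proof -
  have type: "exponential_type_le F pi" and hol: "F holomorphic_on UNIV"
    using F by (auto simp: exp_type_L1_def)
  have pow1: "norm (\<Theta> z ^ n) \<le> norm (\<Theta> z)" if "0 \<le> Im z" for z
    using power_decreasing[OF n norm_ge_zero norm_Theta_le_1[OF that]] by (simp add: norm_power)
  obtain C where C: "\<And>z. norm (F z) \<le> C * exp ((pi + 1) * norm z)"
    using type unfolding exponential_type_le_def by (meson zero_less_one)
  show ?thesis
  proof (rule half_plane_integral_eq_0)
    show "(\<lambda>z. F z * \<Theta> z ^ n) holomorphic_on {z. 0 \<le> Im z}"
      using holomorphic_on_subset[OF hol] by (intro holomorphic_intros Theta_holomorphic) auto
    show "norm (F z * \<Theta> z ^ n) \<le> C * exp ((pi + 1) * norm z)" if "0 \<le> Im z" for z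
      using C[of z] pow1[OF that] norm_Theta_le_1[OF that] mult_left_le[of "norm (\<Theta> z ^ n)" "norm (F z)"]
      by (simp add: norm_mult)
    show "\<exists>B. \<forall>y\<ge>0. norm (F (of_real y * \<i>) * \<Theta> (of_real y * \<i>) ^ n) \<le> B * exp (\<epsilon> * y)"
      if "\<epsilon> > 0" for \<epsilon>
    proof -
      obtain B where B: "\<And>z. norm (F z) \<le> B * exp ((pi + \<epsilon>) * norm z)"
        using type \<open>\<epsilon> > 0\<close> unfolding exponential_type_le_def by meson
      have "norm (F (of_real y * \<i>) * \<Theta> (of_real y * \<i>) ^ n) \<le> B * exp (\<epsilon> * y)" if "y \<ge> 0" for y
      proof -
        have "norm (F (of_real y * \<i>)) \<le> B * exp ((pi + \<epsilon>) * y)"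
          using B[of "of_real y * \<i>"] that by (simp add: norm_mult)
        moreover have "norm (\<Theta> (of_real y * \<i>) ^ n) \<le> exp (- (pi * y))"
          using pow1[of "of_real y * \<i>"] norm_Theta_le[of "of_real y * \<i>"] that by simp
        ultimately have "norm (F (of_real y * \<i>) * \<Theta> (of_real y * \<i>) ^ n) \<le>
            (B * exp ((pi + \<epsilon>) * y)) * exp (- (pi * y))"
          unfolding norm_mult by (intro mult_mono order_trans[OF norm_ge_zero]) auto
        also have "\<dots> = B * exp (\<epsilon> * y)"
          by (simp add: algebra_simps flip: exp_add)
        finally show ?thesis .
      qed
      then show ?thesis by blast
    qed
    show "integrable lborel (\<lambda>x. F (of_real x) * \<Theta> (of_real x) ^ n)"
      by (intro integrable_mult_bounded integrable_exp_type_L1[OF F]) (auto simp: norm_power norm_Theta_real)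
  qed
qed

text \<open>
Stability under \<open>F \<mapsto> cnj \<circ> F \<circ> cnj\<close> turns orthogonality to powers of \<open>\<Theta>\<close> into orthogonality to
  powers of \<open>cnj \<Theta>\<close>, without assuming \<open>F\<close> real on the real axis.
\<close>
lemma exp_type_L1_cnj:
  assumes F: "F \<in> exp_type_L1 \<tau>"
  shows "(\<lambda>z. cnj (F (cnj z))) \<in> exp_type_L1 \<tau>"
proof -
  have "(cnj \<circ> F \<circ> cnj) holomorphic_on UNIV"
    using F by (intro holomorphic_on_compose_cnj_cnj) (auto simp: exp_type_L1_def)
  moreover have "exponential_type_le (\<lambda>z. cnj (F (cnj z))) \<tau>"
    using F unfolding exp_type_L1_def exponential_type_le_def by (simp) (metis complex_mod_cnj)
  ultimately show ?thesis
    using F by (simp add: exp_type_L1_def o_def)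
qed

lemma integral_Theta_powers_eq_0:
  assumes F: "F \<in> exp_type_L1 pi" and jl: "j \<noteq> l"
  shows "(LINT x|lborel. F (of_real x) * (\<Theta> (of_real x) ^ j * cnj (\<Theta> (of_real x)) ^ l)) = 0"
proof -
  have unit: "\<Theta> (of_real x) * cnj (\<Theta> (of_real x)) = 1" for x
    using norm_Theta_real[of x] by (simp add: complex_norm_square[symmetric])
  show ?thesis
  proof (cases "j > l")
    case True
    have "\<Theta> (of_real x) ^ j * cnj (\<Theta> (of_real x)) ^ l = \<Theta> (of_real x) ^ (j - l)" for x
    proof -
      have "\<Theta> (of_real x) ^ j = \<Theta> (of_real x) ^ (j - l) * \<Theta> (of_real x) ^ l"
        using True by (simp flip: power_add)
      then show ?thesis by (simp add: mult.assoc unit flip: power_mult_distrib)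
    qed
    then show ?thesis using integral_Theta_power_eq_0[OF F, of "j - l"] True by simp
  next
    case False
    then have lt: "j < l" using jl by simp
    have "\<Theta> (of_real x) ^ j * cnj (\<Theta> (of_real x)) ^ l = cnj (\<Theta> (of_real x)) ^ (l - j)" for x
    proof -
      have "cnj (\<Theta> (of_real x)) ^ l = cnj (\<Theta> (of_real x)) ^ j * cnj (\<Theta> (of_real x)) ^ (l - j)"
        using lt by (simp flip: power_add)
      then show ?thesis by (simp add: mult.assoc[symmetric] unit flip: power_mult_distrib)
    qed
    moreover have "(LINT x|lborel. cnj (cnj (F (cnj (of_real x))) * \<Theta> (of_real x) ^ (l - j))) = cnj 0"
      using integral_Theta_power_eq_0[OF exp_type_L1_cnj[OF F], of "l - j"] lt
      by (subst Bochner_Integration.integral_cnj) simp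
    ultimately show ?thesis by simp
  qed
qed

text \<open>
On the real line \<open>Re \<Theta> = (\<Theta> + cnj \<Theta>) / 2\<close>, and the binomial expansion of an odd power has no
  middle term, hence no term of zero frequency.
\<close>
lemma integral_Re_Theta_odd_power_eq_0:
  assumes F: "F \<in> exp_type_L1 pi" and n: "odd n"
  shows "(LINT x|lborel. F (of_real x) * of_real (Re (\<Theta> (of_real x))) ^ n) = 0"
proof -
  let ?t = "\<lambda>x. \<Theta> (complex_of_real x)"
  have "F (of_real x) * of_real (Re (?t x)) ^ n =
     (\<Sum>k\<le>n. (of_nat (n choose k) / 2 ^ n) * (F (of_real x) * (?t x ^ k * cnj (?t x) ^ (n - k))))" for x
  proof -
    have "complex_of_real (Re (?t x)) = (?t x + cnj (?t x)) / 2" by (simp add: complex_add_cnj)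
    then show ?thesis
      by (simp only: power_divide binomial_ring sum_distrib_left sum_divide_distrib)
        (auto intro!: sum.cong simp: mult_ac)
  qed
  then have "(LINT x|lborel. F (of_real x) * of_real (Re (?t x)) ^ n) =
     (LINT x|lborel. (\<Sum>k\<le>n. (of_nat (n choose k) / 2 ^ n) * (F (of_real x) * (?t x ^ k * cnj (?t x) ^ (n - k)))))"
    by simp
  also have "\<dots> = (\<Sum>k\<le>n. (LINT x|lborel. (of_nat (n choose k) / 2 ^ n) * (F (of_real x) * (?t x ^ k * cnj (?t x) ^ (n - k)))))"
    by (intro Bochner_Integration.integral_sum integrable_mult_right integrable_mult_bounded integrable_exp_type_L1[OF F])
      (auto simp: norm_mult norm_power norm_Theta_real)
  also have "\<dots> = 0"
  proof (rule sum.neutral, rule ballI)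
    fix k assume "k \<in> {..n}"
    then have "n = 2 * k" if "k = n - k" using that by simp
    then have "k \<noteq> n - k" using n by auto
    then show "(LINT x|lborel. (of_nat (n choose k) / 2 ^ n) * (F (of_real x) * (?t x ^ k * cnj (?t x) ^ (n - k)))) = 0"
      using integral_Theta_powers_eq_0[OF F, of k "n - k"] by simp
  qed
  finally show ?thesis .
qed

text \<open>
The Newton-Schulz iteration \<open>p \<mapsto> p (3 - p\<^sup>2) / 2\<close>, started at \<open>p = t\<close>, produces odd polynomials which
  converge to \<open>sgn t\<close> on \<open>[-1, 1]\<close> and stay in \<open>[-1, 1]\<close>.  Writing \<open>p = t q (t\<^sup>2)\<close> and iterating \<open>q\<close>
  makes oddness visible in the representation.
\<close>
fun sgn_poly :: "nat \<Rightarrow> real poly" where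
  "sgn_poly 0 = 1"
| "sgn_poly (Suc n) = smult (1/2) (sgn_poly n * (3 - [:0, 1:] * sgn_poly n ^ 2))"

definition sgn_approx :: "nat \<Rightarrow> real \<Rightarrow> real" where
  "sgn_approx n t = t * poly (sgn_poly n) (t\<^sup>2)"

lemma sgn_approx_0: "sgn_approx 0 t = t"
  by (simp add: sgn_approx_def)

lemma sgn_approx_Suc: "sgn_approx (Suc n) t = sgn_approx n t * (3 - (sgn_approx n t)\<^sup>2) / 2"
  by (simp add: sgn_approx_def power2_eq_square algebra_simps)

lemma sgn_approx_minus: "sgn_approx n (- t) = - sgn_approx n t"
  by (simp add: sgn_approx_def)

text \<open>
The errors satisfy \<open>1 - p' = (1 - p) (1 - (p + p\<^sup>2) / 2)\<close>, and the last factor is at most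
  \<open>1 - t / 2\<close> as long as \<open>p \<ge> t\<close>.
\<close>
lemma sgn_approx_bounds:
  assumes t: "0 < t" "t \<le> 1"
  shows "t \<le> sgn_approx n t \<and> sgn_approx n t \<le> 1 \<and> 1 - sgn_approx n t \<le> (1 - t / 2) ^ n"
proof (induction n)
  case 0
  then show ?case using t by (simp add: sgn_approx_0)
next
  case (Suc n)
  define p where "p = sgn_approx n t"
  have p: "t \<le> p" "p \<le> 1" "1 - p \<le> (1 - t / 2) ^ n" using Suc by (auto simp: p_def)
  have eq: "1 - sgn_approx (Suc n) t = (1 - p) * (1 - (p + p\<^sup>2) / 2)"
    unfolding sgn_approx_Suc p_def[symmetric] by (simp add: power2_eq_square field_simps)
  have p2: "p\<^sup>2 \<le> 1" using p t by (simp add: power_le_one)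
  have "0 \<le> 1 - (p + p\<^sup>2) / 2"
    using p p2 by argo
  moreover have "1 - (p + p\<^sup>2) / 2 \<le> 1 - t / 2" "1 - (p + p\<^sup>2) / 2 \<le> 1"
    using p t zero_le_power2[of p] by argo+
  ultimately have "(1 - p) * (1 - (p + p\<^sup>2) / 2) \<le> (1 - t / 2) ^ n * (1 - t / 2)"
    "0 \<le> (1 - p) * (1 - (p + p\<^sup>2) / 2)" "(1 - p) * (1 - (p + p\<^sup>2) / 2) \<le> (1 - p) * 1"
    using p t by (auto intro!: mult_mono mult_left_mono mult_nonneg_nonneg simp del: mult_1_right)
  then show ?case using eq p by (simp add: mult.commute)
qed

lemma abs_sgn_approx_le_1:
  assumes "\<bar>t\<bar> \<le> 1"
  shows "\<bar>sgn_approx n t\<bar> \<le> 1"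
proof -
  consider "t = 0" | "t > 0" | "t < 0" by linarith
  then show ?thesis
  proof cases
    case 1
    then show ?thesis by (simp add: sgn_approx_def)
  next
    case 2
    then show ?thesis using sgn_approx_bounds[of t n] assms by auto
  next
    case 3
    then show ?thesis using sgn_approx_bounds[of "- t" n] assms by (auto simp: sgn_approx_minus)
  qed
qed

lemma sgn_approx_tendsto_pos:
  assumes t: "0 < t" "t \<le> 1"
  shows "(\<lambda>n. sgn_approx n t) \<longlonglongrightarrow> 1"
proof -
  have "(\<lambda>n. (1 - t / 2) ^ n) \<longlonglongrightarrow> 0"
    using t by (intro LIMSEQ_realpow_zero) auto
  then have "(\<lambda>n. 1 - sgn_approx n t) \<longlonglongrightarrow> 0"
    by (rule tendsto_sandwich[OF _ _ tendsto_const, rotated 2])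
      (use sgn_approx_bounds[OF t] in auto)
  from tendsto_diff[OF tendsto_const[of 1] this] show ?thesis by simp
qed

lemma sgn_approx_tendsto:
  assumes "\<bar>t\<bar> \<le> 1"
  shows "(\<lambda>n. sgn_approx n t) \<longlonglongrightarrow> sgn t"
proof -
  consider "t = 0" | "t > 0" | "t < 0" by linarith
  then show ?thesis
  proof cases
    case 1
    then show ?thesis by (simp add: sgn_approx_def)
  next
    case 2
    then show ?thesis using sgn_approx_tendsto_pos[of t] assms by simp
  next
    case 3
    then show ?thesis
      using tendsto_minus[OF sgn_approx_tendsto_pos[of "- t"]] assms by (simp add: sgn_approx_minus)
  qed
qed

lemma integral_sgn_Re_Theta_eq_0:
  assumes F: "F \<in> exp_type_L1 pi"
  shows "(LINT x|lborel. F (of_real x) * of_real (sgn (Re (\<Theta> (of_real x))))) = 0"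
proof -
  define t where "t = (\<lambda>x. Re (\<Theta> (complex_of_real x)))"
  have t_meas[measurable]: "t \<in> borel_measurable borel" unfolding t_def by measurable
  have t1: "\<bar>t x\<bar> \<le> 1" for x
    unfolding t_def using abs_Re_le_cmod[of "\<Theta> (of_real x)"] by (simp add: norm_Theta_real)
  have F_meas: "(\<lambda>x. F (of_real x)) \<in> borel_measurable lborel"
    using integrable_exp_type_L1[OF F] by (rule borel_measurable_integrable)
  have sgn_meas: "(\<lambda>x. sgn_approx n (t x)) \<in> borel_measurable borel" for n
    by (induction n) (simp_all add: sgn_approx_0 sgn_approx_Suc)
  have zero: "(LINT x|lborel. F (of_real x) * of_real (sgn_approx n (t x))) = 0" for n
  proof -
    let ?q = "sgn_poly n"
    have int: "integrable lborel (\<lambda>x. F (of_real x) * of_real (t x) ^ k)" for k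
      by (intro integrable_mult_bounded integrable_exp_type_L1[OF F]) (auto simp: norm_power t1 power_le_one)
    have "F (of_real x) * of_real (sgn_approx n (t x)) =
        (\<Sum>i\<le>degree ?q. of_real (coeff ?q i) * (F (of_real x) * of_real (t x) ^ (2 * i + 1)))" for x
    proof -
      have "of_real (t x) ^ (2 * i + 1) = of_real (t x) * (of_real ((t x)\<^sup>2) ^ i :: complex)" for i
        by (simp add: power_mult)
      then show ?thesis unfolding sgn_approx_def poly_altdef
        by (simp only: of_real_mult of_real_sum of_real_power sum_distrib_left mult_ac)
    qed
    then have "(LINT x|lborel. F (of_real x) * of_real (sgn_approx n (t x))) =
       (LINT x|lborel. (\<Sum>i\<le>degree ?q. of_real (coeff ?q i) * (F (of_real x) * of_real (t x) ^ (2 * i + 1))))"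
      by (simp only:)
    also have "\<dots> = (\<Sum>i\<le>degree ?q. (LINT x|lborel. of_real (coeff ?q i) * (F (of_real x) * of_real (t x) ^ (2 * i + 1))))"
      by (intro Bochner_Integration.integral_sum integrable_mult_right int)
    also have "\<dots> = 0"
    proof (rule sum.neutral, rule ballI)
      fix i
      show "(LINT x|lborel. of_real (coeff ?q i) * (F (of_real x) * of_real (t x) ^ (2 * i + 1))) = 0"
        using integral_Re_Theta_odd_power_eq_0[OF F, of "2 * i + 1"] by (simp add: t_def)
    qed
    finally show ?thesis .
  qed
  have "(\<lambda>n. LINT x|lborel. F (of_real x) * of_real (sgn_approx n (t x)))
      \<longlonglongrightarrow> (LINT x|lborel. F (of_real x) * of_real (sgn (t x)))"
  proof (rule integral_dominated_convergence[where w="\<lambda>x. norm (F (of_real x))"])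
    show "(\<lambda>x. F (of_real x) * of_real (sgn (t x))) \<in> borel_measurable lborel"
      using F_meas by simp
    show "(\<lambda>x. F (of_real x) * of_real (sgn_approx n (t x))) \<in> borel_measurable lborel" for n
      using F_meas sgn_meas[of n] by simp
    show "AE x in lborel. (\<lambda>n. F (of_real x) * of_real (sgn_approx n (t x))) \<longlonglongrightarrow> F (of_real x) * of_real (sgn (t x))"
      by (intro AE_I2 tendsto_intros sgn_approx_tendsto t1)
    show "AE x in lborel. norm (F (of_real x) * of_real (sgn_approx n (t x))) \<le> norm (F (of_real x))" for n
      by (auto simp: norm_mult intro!: mult_left_le abs_sgn_approx_le_1 t1)
  qed (use integrable_exp_type_L1[OF F] in auto)
  then have "(LINT x|lborel. F (of_real x) * of_real (sgn (t x))) = 0"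
    unfolding zero by (simp add: LIMSEQ_const_iff)
  then show ?thesis by (simp add: t_def)
qed

section \<open>The sign pattern on the unit interval\<close>

definition G :: "real \<Rightarrow> real" where
  "G x = (x\<^sup>2 - 1) * cos (pi * x) + 2 * x * sin (pi * x)"

lemma G_minus: "G (- x) = G x"
  by (simp add: G_def)

lemma G_1: "G 1 = 0"
  by (simp add: G_def)

lemma G_strict_mono:
  assumes "0 \<le> x" "x < y" "y \<le> 1/2"
  shows "G x < G y"
proof (rule DERIV_pos_imp_increasing_open[OF \<open>x < y\<close>])
  fix t assume t: "x < t" "t < y"
  then have t2: "0 < t" "t < 1/2" using assms by auto
  have pit: "0 < pi * t" "pi * t < pi / 2"
    using t2 pi_gt_zero mult_strict_left_mono[of t "1/2" pi] by simp_all
  let ?d = "2 * t * cos (pi * t) + (1 - t\<^sup>2) * (pi * sin (pi * t)) + 2 * sin (pi * t) + 2 * t * (pi * cos (pi * t))"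
  have "(G has_real_derivative ?d) (at t)"
    unfolding G_def[abs_def]
    by (rule derivative_eq_intros refl | simp)+ (simp add: algebra_simps)
  moreover have "cos (pi * t) > 0" "sin (pi * t) > 0"
    using pit by (auto intro!: cos_gt_zero sin_gt_zero)
  moreover have "t\<^sup>2 < 1" using t2 by (simp add: power_less_one_iff)
  ultimately show "\<exists>d. (G has_real_derivative d) (at t) \<and> d > 0"
    using t2 by (intro exI[of _ ?d]) (auto intro!: add_pos_pos mult_pos_pos)
next
  show "continuous_on {x..y} G"
    unfolding G_def[abs_def] by (intro continuous_intros)
qed

lemma G_pos_right:
  assumes "1/2 \<le> x" "x < 1"
  shows "G x > 0"
proof -
  have p: "pi / 2 \<le> pi * x" "pi * x < pi"
    using assms mult_left_mono[of "1/2" x pi] mult_strict_left_mono[of x 1 pi] by simp_all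
  then have "sin (pi * x) > 0" using pi_half_gt_zero by (intro sin_gt_zero) linarith+
  moreover have "cos (pi * x) \<le> 0"
  proof -
    have "cos (pi * x) \<le> cos (pi / 2)" using p by (intro cos_monotone_0_pi_le) auto
    then show ?thesis by simp
  qed
  moreover have "x\<^sup>2 \<le> 1" using assms by (simp add: power_le_one)
  ultimately show ?thesis
    unfolding G_def using assms by (intro add_nonneg_pos mult_nonpos_nonpos mult_pos_pos) auto
qed

lemma G_sgn:
  assumes y: "0 < y" "y < 1/2" "G y = 0"
  shows "\<bar>x\<bar> < y \<Longrightarrow> G x < 0" "y < \<bar>x\<bar> \<Longrightarrow> \<bar>x\<bar> < 1 \<Longrightarrow> G x > 0"
proof -
  have abs: "G x = G \<bar>x\<bar>" by (simp add: abs_if G_minus)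
  show "G x < 0" if "\<bar>x\<bar> < y"
    unfolding abs using G_strict_mono[of "\<bar>x\<bar>" y] that y by simp
  show "G x > 0" if "y < \<bar>x\<bar>" "\<bar>x\<bar> < 1"
    unfolding abs using G_strict_mono[of y "\<bar>x\<bar>"] G_pos_right[of "\<bar>x\<bar>"] that y
    by (cases "\<bar>x\<bar> \<le> 1/2") auto
qed

text \<open>
\<open>D\<close> has a double zero at \<open>s0\<close> and a zero at 1.  Rolle's theorem supplies a further zero \<open>t\<close> of the
  convex function \<open>E = - D'\<close> between them, so \<open>E\<close> is nonpositive on \<open>[s0, t]\<close> and nonnegative elsewhere: \<open>D\<close> falls to 0 at
  \<open>s0\<close>, rises up to \<open>t\<close> and falls back to 0 at 1.
\<close>
lemma nonneg_if_deriv_concave: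
  fixes D E :: "real \<Rightarrow> real"
  assumes s0: "0 < s0" "s0 < 1"
    and D: "\<And>s. 0 < s \<Longrightarrow> (D has_real_derivative - E s) (at s)"
    and E: "convex_on {0<..1} E"
    and zeros: "D s0 = 0" "D 1 = 0" "E s0 = 0"
    and s: "0 < s" "s \<le> 1"
  shows "D s \<ge> 0"
proof -
  have "\<exists>t. s0 < t \<and> t < 1 \<and> (D has_real_derivative 0) (at t)"
    using s0 zeros D by (intro Rolle) (auto intro!: continuous_at_imp_continuous_on DERIV_isCont[OF D]
        simp: real_differentiable_def intro!: exI D)
  then obtain t where t: "s0 < t" "t < 1" "(D has_real_derivative 0) (at t)" by blast
  have "- E t = 0" using DERIV_unique[OF D t(3)] s0 t by simp
  then have Et: "E t = 0" by simp
  have cvx: "E c \<le> (E b - E a) / (b - a) * (c - a) + E a" if "0 < a" "a \<le> c" "c \<le> b" "b \<le> 1" for a b c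
    using that by (intro convex_onD_Icc' convex_on_subset[OF E]) auto
  have left: "E r \<ge> 0" if "0 < r" "r \<le> s0" for r
  proof -
    have "0 \<le> (0 - E r) / (t - r) * (s0 - r) + E r"
      using cvx[of r s0 t] that t zeros Et by simp
    also have "\<dots> = E r * ((t - s0) / (t - r))"
      using that t by (simp add: field_simps)
    finally show ?thesis using that t by (simp add: zero_le_mult_iff zero_le_divide_iff)
  qed
  have middle: "E r \<le> 0" if "s0 \<le> r" "r \<le> t" for r
    using cvx[of s0 r t] that t zeros Et s0 by simp
  have right: "E r \<ge> 0" if "t \<le> r" "r \<le> 1" for r
  proof -
    have "0 \<le> E r / (r - s0) * (t - s0)"
      using cvx[of s0 t r] that t zeros Et s0 by simp
    then show ?thesis using that t by (simp add: zero_le_mult_iff zero_le_divide_iff)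
  qed
  consider "s \<le> s0" | "s0 \<le> s" "s \<le> t" | "t \<le> s" by linarith
  then show ?thesis
  proof cases
    case 1
    have "D s0 \<le> D s"
      by (rule DERIV_nonpos_imp_nonincreasing[OF 1]) (use D left s in \<open>force\<close>)
    then show ?thesis using zeros by simp
  next
    case 2
    have "D s0 \<le> D s"
      by (rule DERIV_nonneg_imp_nondecreasing[OF 2(1)]) (use D middle s0 2 in \<open>force\<close>)
    then show ?thesis using zeros by simp
  next
    case 3
    have "D 1 \<le> D s"
      by (rule DERIV_nonpos_imp_nonincreasing[OF s(2)]) (use D right s 3 in \<open>force\<close>)
    then show ?thesis using zeros by simp
  qed
qed

section \<open>Comparison of the numerator with a quadratic polynomial\<close>

text \<open>
  In the variable \<open>s = x\<^sup>2\<close>, the function \<open>j0\<close> is \<open>sin (pi x) / x\<close> and \<open>j1\<close>, \<open>j2\<close> are its first two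
  derivatives; up to positive factors and alternating signs these are the spherical Bessel functions
  of order 0, 1, 2.
\<close>
definition c0 :: "real \<Rightarrow> real" where "c0 s = cos (pi * sqrt s)"
definition j0 :: "real \<Rightarrow> real" where "j0 s = sin (pi * sqrt s) / sqrt s"
definition j1 :: "real \<Rightarrow> real" where "j1 s = (pi * c0 s - j0 s) / (2 * s)"
definition j2 :: "real \<Rightarrow> real" where "j2 s = - (3 * j1 s + pi\<^sup>2 / 2 * j0 s) / (2 * s)"

lemma DERIV_c0: "0 < s \<Longrightarrow> (c0 has_real_derivative - (pi / 2 * j0 s)) (at s)"
  unfolding c0_def[abs_def] j0_def
  by (rule derivative_eq_intros refl | simp)+ (simp add: field_simps)

lemma DERIV_j0: "0 < s \<Longrightarrow> (j0 has_real_derivative j1 s) (at s)"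
  unfolding j0_def[abs_def] j1_def c0_def
  by (rule derivative_eq_intros refl | simp)+ (simp add: field_simps)

lemma DERIV_j1: "0 < s \<Longrightarrow> (j1 has_real_derivative j2 s) (at s)"
  unfolding j1_def[abs_def]
  by (rule derivative_eq_intros DERIV_c0 DERIV_j0 refl | simp)+
    (simp add: j2_def j1_def field_simps power2_eq_square)

lemma mult_cos_le_sin:
  fixes t :: real
  assumes "0 \<le> t" "t \<le> pi"
  shows "t * cos t \<le> sin t"
proof -
  have "sin 0 - 0 * cos 0 \<le> sin t - t * cos t"
  proof (rule DERIV_nonneg_imp_nondecreasing[OF assms(1)])
    fix r assume r: "0 \<le> r" "r \<le> t"
    have "((\<lambda>r. sin r - r * cos r) has_real_derivative r * sin r) (at r)"
      by (rule derivative_eq_intros refl | simp)+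
    then show "\<exists>y. ((\<lambda>r. sin r - r * cos r) has_real_derivative y) (at r) \<and> 0 \<le> y"
      using r assms by (auto intro!: mult_nonneg_nonneg sin_ge_zero)
  qed
  then show ?thesis by simp
qed

lemma mult_cos_le_sin_2:
  fixes t :: real
  assumes "0 \<le> t" "t \<le> pi"
  shows "3 * t * cos t \<le> (3 - t\<^sup>2) * sin t"
proof -
  have "(3 - 0\<^sup>2) * sin 0 - 3 * 0 * cos 0 \<le> (3 - t\<^sup>2) * sin t - 3 * t * cos t"
  proof (rule DERIV_nonneg_imp_nondecreasing[OF assms(1)])
    fix r assume r: "0 \<le> r" "r \<le> t"
    have "((\<lambda>r. (3 - r\<^sup>2) * sin r - 3 * r * cos r) has_real_derivative r * (sin r - r * cos r)) (at r)"
      by (rule derivative_eq_intros refl | simp)+ (simp add: algebra_simps power2_eq_square)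
    then show "\<exists>y. ((\<lambda>r. (3 - r\<^sup>2) * sin r - 3 * r * cos r) has_real_derivative y) (at r) \<and> 0 \<le> y"
      using r assms mult_cos_le_sin[of r] by (intro exI[of _ "r * (sin r - r * cos r)"]) simp
  qed
  then show ?thesis by simp
qed

text \<open>
Spherical Bessel functions of order 1 and 2 are positive up to \<open>pi\<close>; with \<open>t = pi x\<close> this is what
  \<open>mult_cos_le_sin\<close> and \<open>mult_cos_le_sin_2\<close> say.
\<close>
lemma j_signs:
  assumes s: "0 < s" "s \<le> 1"
  shows "j1 s \<le> 0" "j2 s \<ge> 0"
proof -
  define x where "x = sqrt s"
  have x: "0 < x" "x \<le> 1" "s = x\<^sup>2" using s by (auto simp: x_def)
  have p: "0 \<le> pi * x" "pi * x \<le> pi" using x by (simp_all add: mult_left_le)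
  have j1: "j1 s = (pi * x * cos (pi * x) - sin (pi * x)) / (2 * x ^ 3)"
    using x by (simp add: j1_def c0_def j0_def field_simps power2_eq_square power3_eq_cube)
  show "j1 s \<le> 0" unfolding j1
    using x mult_cos_le_sin[OF p] by (intro divide_nonpos_pos) auto
  have "j2 s = ((3 - (pi * x)\<^sup>2) * sin (pi * x) - 3 * (pi * x) * cos (pi * x)) / (4 * x ^ 5)"
    using x unfolding j2_def j1
    by (simp add: j0_def field_simps power2_eq_square eval_nat_numeral)
  also have "\<dots> \<ge> 0"
    using x mult_cos_le_sin_2[OF p] by (intro divide_nonneg_pos) auto
  finally show "j2 s \<ge> 0" .
qed

text \<open>
  \<open>G\<close> as a function of \<open>s = x\<^sup>2\<close>, and its first three derivatives.
\<close>
definition g where "g s = (s - 1) * c0 s + 2 * s * j0 s"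
definition g1 where "g1 s = (1 + pi) * c0 s + (1 + pi / 2 * (1 - s)) * j0 s"
definition g2 where "g2 s = - (pi + pi\<^sup>2 / 2) * j0 s + (1 + pi / 2 * (1 - s)) * j1 s"
definition g3 where "g3 s = - (3 * pi / 2 + pi\<^sup>2 / 2) * j1 s + (1 + pi / 2 * (1 - s)) * j2 s"

lemma DERIV_g: "0 < s \<Longrightarrow> (g has_real_derivative g1 s) (at s)"
  unfolding g_def[abs_def]
  by (rule derivative_eq_intros DERIV_c0 DERIV_j0 refl | assumption | simp)+
    (simp add: g1_def j1_def field_simps power2_eq_square)

lemma DERIV_g1: "0 < s \<Longrightarrow> (g1 has_real_derivative g2 s) (at s)"
  unfolding g1_def[abs_def]
  by (rule derivative_eq_intros DERIV_c0 DERIV_j0 refl | assumption | simp)+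
    (simp add: g2_def field_simps power2_eq_square)

lemma DERIV_g2: "0 < s \<Longrightarrow> (g2 has_real_derivative g3 s) (at s)"
  unfolding g2_def[abs_def]
  by (rule derivative_eq_intros DERIV_j0 DERIV_j1 refl | assumption | simp)+
    (simp add: g3_def field_simps power2_eq_square)

lemma g3_nonneg: "0 < s \<Longrightarrow> s \<le> 1 \<Longrightarrow> g3 s \<ge> 0"
proof -
  assume s: "0 < s" "s \<le> 1"
  have "- (3 * pi / 2 + pi\<^sup>2 / 2) * j1 s \<ge> 0"
    using pi_gt_zero zero_le_power2[of pi] j_signs(1)[OF s] by (intro mult_nonpos_nonpos) argo
  moreover have "(1 + pi / 2 * (1 - s)) * j2 s \<ge> 0"
    using s j_signs(2)[OF s] by (intro mult_nonneg_nonneg) (simp_all add: add_nonneg_nonneg)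
  ultimately show ?thesis by (simp only: g3_def add_nonneg_nonneg)
qed

lemma G_eq_g: "0 < x \<Longrightarrow> G x = g (x\<^sup>2)"
  by (simp add: G_def g_def c0_def j0_def field_simps power2_eq_square)

lemma g1_pos:
  assumes "0 < y" "y < 1/2"
  shows "g1 (y\<^sup>2) > 0"
proof -
  have p: "0 < pi * y" "pi * y < pi / 2"
    using assms mult_strict_left_mono[of y "1/2" pi] by simp_all
  then have "cos (pi * y) > 0" "sin (pi * y) > 0"
    by (auto intro!: cos_gt_zero sin_gt_zero)
  moreover have "y\<^sup>2 < 1" using assms by (simp add: power_less_one_iff)
  ultimately show ?thesis
    using assms unfolding g1_def c0_def j0_def
    by (intro add_pos_pos mult_pos_pos divide_pos_pos) (auto intro!: add_pos_nonneg)
qed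

text \<open>
  The normalisation for which \<open>amp y * G x / ((x\<^sup>2 - y\<^sup>2) (1 - x\<^sup>2))\<close> takes the value 1 at its removable
  singularity \<open>x = y\<close>.
\<close>
definition amp :: "real \<Rightarrow> real" where
  "amp y = (1 - y\<^sup>2) / g1 (y\<^sup>2)"

lemma amp_pos: "0 < y \<Longrightarrow> y < 1/2 \<Longrightarrow> amp y > 0"
  unfolding amp_def using g1_pos[of y] by (intro divide_pos_pos) (auto simp: power_less_one_iff)

text \<open>
The difference of the two sides has a double zero in \<open>s = x\<^sup>2\<close> at \<open>y\<^sup>2\<close>, by the choice of \<open>amp\<close>, and a
  zero at 1.  Its derivative is concave because the quadratic polynomial has vanishing third
  derivative while that of \<open>g\<close> is nonnegative.
\<close>
lemma amp_G_le_quadratics: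
  assumes y: "0 < y" "y < 1/2" "G y = 0" and x: "0 < \<bar>x\<bar>" "\<bar>x\<bar> \<le> 1"
  shows "amp y * G x \<le> (x\<^sup>2 - y\<^sup>2) * (1 - x\<^sup>2)"
proof -
  define D where "D = (\<lambda>s. (s - y\<^sup>2) * (1 - s) - amp y * g s)"
  define E where "E = (\<lambda>s. amp y * g1 s + 2 * s - y\<^sup>2 - 1)"
  have "D (x\<^sup>2) \<ge> 0"
  proof (rule nonneg_if_deriv_concave[where D = D and E = E and ?s0.0 = "y\<^sup>2"])
    show "(D has_real_derivative - E s) (at s)" if "0 < s" for s
      unfolding D_def E_def by (rule derivative_eq_intros DERIV_g that refl | simp add: algebra_simps)+
    show "convex_on {0<..1} E"
    proof (rule f''_ge0_imp_convex[where f' = "\<lambda>s. amp y * g2 s + 2" and f'' = "\<lambda>s. amp y * g3 s"])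
      show "(E has_real_derivative amp y * g2 s + 2) (at s)" if "s \<in> {0<..1}" for s
        unfolding E_def using that by (auto intro!: derivative_eq_intros DERIV_g1)
      show "((\<lambda>s. amp y * g2 s + 2) has_real_derivative amp y * g3 s) (at s)" if "s \<in> {0<..1}" for s
        using that by (auto intro!: derivative_eq_intros DERIV_g2)
      show "amp y * g3 s \<ge> 0" if "s \<in> {0<..1}" for s
        using that g3_nonneg[of s] amp_pos[OF y(1,2)] by auto
    qed simp
    show "D (y\<^sup>2) = 0" using y G_eq_g[of y] by (simp add: D_def)
    show "D 1 = 0" using G_eq_g[of 1] G_1 by (simp add: D_def)
    show "E (y\<^sup>2) = 0" using g1_pos[OF y(1,2)] by (simp add: E_def amp_def)
    show "x\<^sup>2 \<le> 1" using x(2) by (simp add: abs_square_le_1)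
  qed (use x y in \<open>auto simp: power_less_one_iff\<close>)
  moreover have "G x = g (x\<^sup>2)" using G_eq_g[of "\<bar>x\<bar>"] x by (simp add: abs_if G_minus split: if_splits)
  ultimately show ?thesis by (simp add: D_def)
qed

section \<open>The lower bound\<close>

lemma sgn_Re_Theta: "sgn (Re (\<Theta> (of_real x))) = sgn (G x)"
proof -
  have ne: "of_real x + \<i> \<noteq> 0" "x\<^sup>2 + 1 > 0" by (auto simp: complex_eq_iff add_nonneg_pos)
  have "(of_real x - \<i>) / (of_real x + \<i>) = Complex ((x\<^sup>2 - 1) / (x\<^sup>2 + 1)) (- 2 * x / (x\<^sup>2 + 1))"
    using ne by (simp add: complex_eq_iff Re_divide Im_divide power2_eq_square)
  moreover have "exp (\<i> * pi * of_real x) = Complex (cos (pi * x)) (sin (pi * x))"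
    by (simp add: complex_eq_iff Re_exp Im_exp)
  ultimately have "Re (\<Theta> (of_real x)) = G x / (x\<^sup>2 + 1)"
    unfolding \<Theta>_def by (simp add: G_def add_divide_distrib diff_divide_distrib algebra_simps)
  then show ?thesis using ne by (simp add: sgn_divide)
qed

lemma G_measurable [measurable]: "G \<in> borel_measurable borel"
  unfolding G_def[abs_def] by measurable

lemma integral_sgn_G_eq_0:
  assumes "F \<in> exp_type_L1 pi"
  shows "(LINT x|lborel. F (of_real x) * of_real (sgn (G x))) = 0"
  using integral_sgn_Re_Theta_eq_0[OF assms] by (simp add: sgn_Re_Theta)

abbreviation chi :: "real \<Rightarrow> complex" where "chi \<equiv> indicator {-1<..<1}"

lemma integrable_chi: "integrable lborel chi"
proof -
  have "integrable lborel (indicator {-1<..<1} :: real \<Rightarrow> real)"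
    by (rule integrable_real_indicator) auto
  then have "integrable lborel (\<lambda>x::real. complex_of_real (indicator {-1<..<1} x))"
    by (rule Bochner_Integration.integrable_of_real)
  then show ?thesis by (simp only: of_real_indicator)
qed

lemma integral_chi_sgn_G:
  assumes y: "0 < y" "y < 1/2" "G y = 0"
  shows "(LINT x|lborel. chi x * of_real (sgn (G x))) = of_real (2 - 4 * y)"
proof -
  let ?h = "\<lambda>x. indicator {y<..<1} x + indicator {-1<..<-y} x - indicator {-y<..<y} x :: real"
  have "chi x * of_real (sgn (G x)) = of_real (?h x)" for x
  proof -
    have "G (- y) = 0" using y G_minus by simp
    then show ?thesis
      using G_sgn[OF y, of x] y by (cases "x = y"; cases "x = - y"; auto simp: indicator_def abs_if)
  qed
  then have "(LINT x|lborel. chi x * of_real (sgn (G x))) = of_real (LINT x|lborel. ?h x)"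
    by (simp only: integral_complex_of_real)
  also have "(LINT x|lborel. ?h x) = measure lborel {y<..<1} + measure lborel {-1<..<-y} - measure lborel {-y<..<y}"
  proof -
    have int: "integrable lborel (\<lambda>x. indicator {a<..<b} x :: real)" if "a \<le> b" for a b :: real
      using that by (intro integrable_real_indicator) auto
    then show ?thesis
      using y by (simp add: Bochner_Integration.integral_diff Bochner_Integration.integral_add)
  qed
  also have "\<dots> = 2 - 4 * y" using y by simp
  finally show ?thesis .
qed

lemma integral_diff_sgn_G:
  assumes F: "F \<in> exp_type_L1 pi" and y: "0 < y" "y < 1/2" "G y = 0"
  shows "(LINT x|lborel. (chi x - F (of_real x)) * of_real (sgn (G x))) = of_real (2 - 4 * y)"
proof -
  have le1: "norm (of_real (sgn (G x)) :: complex) \<le> 1" for x by (simp add: sgn_if)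
  have "(LINT x|lborel. (chi x - F (of_real x)) * of_real (sgn (G x))) =
      (LINT x|lborel. chi x * of_real (sgn (G x)) - F (of_real x) * of_real (sgn (G x)))"
    by (simp add: left_diff_distrib)
  also have "\<dots> = (LINT x|lborel. chi x * of_real (sgn (G x))) - (LINT x|lborel. F (of_real x) * of_real (sgn (G x)))"
    by (intro Bochner_Integration.integral_diff integrable_mult_bounded integrable_chi integrable_exp_type_L1[OF F] le1) auto
  finally show ?thesis using integral_chi_sgn_G[OF y] integral_sgn_G_eq_0[OF F] by simp
qed

text \<open>
Integrating against a function of modulus at most 1 that annihilates \<open>F\<close> gives a bound that does
  not depend on \<open>F\<close>.
\<close>
lemma best_L1_lower:
  assumes F: "F \<in> exp_type_L1 pi" and y: "0 < y" "y < 1/2" "G y = 0"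
  shows "2 - 4 * y \<le> (LINT x|lborel. norm (chi x - F (of_real x)))"
proof -
  have int: "integrable lborel (\<lambda>x. chi x - F (of_real x))"
    using integrable_chi integrable_exp_type_L1[OF F] by (rule Bochner_Integration.integrable_diff)
  have "2 - 4 * y = norm (LINT x|lborel. (chi x - F (of_real x)) * of_real (sgn (G x)))"
    unfolding integral_diff_sgn_G[OF F y] norm_of_real using y by simp
  also have "\<dots> \<le> (LINT x|lborel. norm ((chi x - F (of_real x)) * of_real (sgn (G x))))"
    by (rule integral_norm_bound)
  also have "\<dots> \<le> (LINT x|lborel. norm (chi x - F (of_real x)))"
  proof (rule integral_mono)
    show "integrable lborel (\<lambda>x. norm ((chi x - F (of_real x)) * of_real (sgn (G x))))"
      by (intro integrable_norm integrable_mult_bounded int) (auto simp: sgn_if)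
    show "integrable lborel (\<lambda>x. norm (chi x - F (of_real x)))"
      by (intro integrable_norm int)
  qed (auto simp: norm_mult sgn_if)
  finally show ?thesis .
qed

section \<open>The extremal function\<close>

definition Gc :: "complex \<Rightarrow> complex" where
  "Gc z = (z\<^sup>2 - 1) * cos (of_real pi * z) + 2 * z * sin (of_real pi * z)"

lemma Gc_of_real: "Gc (of_real x) = of_real (G x)"
  by (simp add: Gc_def G_def flip: cos_of_real sin_of_real)

lemma norm_Gc_le: "norm (Gc z) \<le> (norm z + 1)\<^sup>2 * exp (pi * norm z)"
proof -
  have e: "norm (exp (\<i> * w)) \<le> exp (norm w)" "norm (exp (- (\<i> * w))) \<le> exp (norm w)" for w
    using abs_Im_le_cmod[of w] by (auto simp: norm_exp_eq_Re)
  have c: "norm (cos w) \<le> exp (norm w)" and s: "norm (sin w) \<le> exp (norm w)" for w :: complex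
  proof -
    have "norm (exp (\<i> * w) + exp (- (\<i> * w))) \<le> 2 * exp (norm w)"
      "norm (exp (\<i> * w) - exp (- (\<i> * w))) \<le> 2 * exp (norm w)"
      using norm_triangle_ineq[of "exp (\<i> * w)" "exp (- (\<i> * w))"]
        norm_triangle_ineq4[of "exp (\<i> * w)" "exp (- (\<i> * w))"] e[of w] by linarith+
    then show "norm (cos w) \<le> exp (norm w)" "norm (sin w) \<le> exp (norm w)"
      by (simp_all add: cos_exp_eq sin_exp_eq norm_divide norm_mult)
  qed
  have "norm (z\<^sup>2 - 1) \<le> (norm z)\<^sup>2 + 1"
    using norm_triangle_ineq4[of "z\<^sup>2" 1] by (simp add: norm_power)
  then have "norm (z\<^sup>2 - 1) * norm (cos (of_real pi * z)) + 2 * norm z * norm (sin (of_real pi * z)) \<le>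
      ((norm z)\<^sup>2 + 1) * exp (pi * norm z) + 2 * norm z * exp (pi * norm z)"
    using c[of "of_real pi * z"] s[of "of_real pi * z"] by (intro add_mono mult_mono) (auto simp: norm_mult)
  also have "\<dots> = (norm z + 1)\<^sup>2 * exp (pi * norm z)"
    by (simp add: power2_eq_square algebra_simps)
  finally show ?thesis
    unfolding Gc_def using norm_triangle_ineq[of "(z\<^sup>2 - 1) * cos (of_real pi * z)" "2 * z * sin (of_real pi * z)"]
    by (simp add: norm_mult)
qed

lemma entire_divide_root:
  assumes "f holomorphic_on UNIV" "f a = 0"
  obtains h where "h holomorphic_on UNIV" "\<And>z. f z = (z - a) * h z"
proof
  show "(\<lambda>z. if z = a then deriv f a else (f z - f a) / (z - a)) holomorphic_on UNIV"
    using assms(1) by (rule pole_lemma_open) simp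
  show "f z = (z - a) * (if z = a then deriv f a else (f z - f a) / (z - a))" for z
    using assms(2) by simp
qed

lemma Gc_divided:
  assumes y: "0 < y" "y < 1/2" "G y = 0"
  obtains H where "H holomorphic_on UNIV" "\<And>z. Gc z = (z\<^sup>2 - (of_real y)\<^sup>2) * (z\<^sup>2 - 1) * H z"
proof -
  have ne: "complex_of_real y \<noteq> 0" "complex_of_real y \<noteq> 1" "complex_of_real y \<noteq> -1"
    using y by (auto simp: complex_eq_iff)
  have zeros: "Gc (of_real y) = 0" "Gc (- of_real y) = 0" "Gc 1 = 0" "Gc (- 1) = 0"
    using y G_1 Gc_of_real[of y] Gc_of_real[of "- y"] Gc_of_real[of 1] Gc_of_real[of "- 1"]
    by (simp_all add: G_minus)
  have "Gc holomorphic_on UNIV" unfolding Gc_def by (intro holomorphic_intros)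
  then obtain h1 where h1: "h1 holomorphic_on UNIV" "\<And>z. Gc z = (z - of_real y) * h1 z"
    using entire_divide_root zeros(1) by blast
  have "h1 (- of_real y) = 0" "h1 1 = 0" "h1 (- 1) = 0"
    using zeros(2-4) ne unfolding h1(2) by auto
  obtain h2 where h2: "h2 holomorphic_on UNIV" "\<And>z. h1 z = (z - (- of_real y)) * h2 z"
    using entire_divide_root[OF h1(1) \<open>h1 (- of_real y) = 0\<close>] by blast
  have "h2 1 = 0" "h2 (- 1) = 0"
    using \<open>h1 1 = 0\<close> \<open>h1 (- 1) = 0\<close> ne unfolding h2(2) by (auto simp: add_eq_0_iff)
  obtain h3 where h3: "h3 holomorphic_on UNIV" "\<And>z. h2 z = (z - 1) * h3 z"
    using entire_divide_root[OF h2(1) \<open>h2 1 = 0\<close>] by blast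
  have "h3 (- 1) = 0" using \<open>h2 (- 1) = 0\<close> unfolding h3(2) by simp
  obtain H where H: "H holomorphic_on UNIV" "\<And>z. h3 z = (z - (- 1)) * H z"
    using entire_divide_root[OF h3(1) \<open>h3 (- 1) = 0\<close>] by blast
  show thesis
  proof (rule that[OF H(1)])
    show "Gc z = (z\<^sup>2 - (of_real y)\<^sup>2) * (z\<^sup>2 - 1) * H z" for z
      unfolding h1(2) h2(2) h3(2) H(2) by (simp add: power2_eq_square algebra_simps)
  qed
qed

text \<open>
Dividing by a polynomial of degree 4 does not change the type, and since \<open>G\<close> grows quadratically on
  the real line the quotient decays like \<open>1 / x\<^sup>2\<close>.
\<close>
lemma divided_in_exp_type_L1:
  assumes y: "0 < y" "y < 1/2"
    and hol: "H holomorphic_on UNIV" and H: "\<And>z. Gc z = (z\<^sup>2 - (of_real y)\<^sup>2) * (z\<^sup>2 - 1) * H z"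
  shows "(\<lambda>z. c * H z) \<in> exp_type_L1 pi"
proof -
  have far: "norm (H z) \<le> norm (Gc z) / ((norm z)\<^sup>2 - 1)\<^sup>2" if z: "norm z \<ge> 2" for z
  proof -
    have r: "(norm z)\<^sup>2 - 1 > 0" using z power_mono[of 2 "norm z" 2] by simp
    have "norm (z\<^sup>2 - (of_real y)\<^sup>2) \<ge> (norm z)\<^sup>2 - y\<^sup>2"
      using norm_triangle_ineq2[of "z\<^sup>2" "(of_real y)\<^sup>2"] by (simp add: norm_power)
    moreover have "y\<^sup>2 \<le> 1" using y by (simp add: power_le_one)
    ultimately have a: "norm (z\<^sup>2 - (of_real y)\<^sup>2) \<ge> (norm z)\<^sup>2 - 1" by linarith
    have b: "norm (z\<^sup>2 - 1) \<ge> (norm z)\<^sup>2 - 1"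
      using norm_triangle_ineq2[of "z\<^sup>2" 1] by (simp add: norm_power)
    have "((norm z)\<^sup>2 - 1)\<^sup>2 * norm (H z) \<le> norm (z\<^sup>2 - (of_real y)\<^sup>2) * norm (z\<^sup>2 - 1) * norm (H z)"
      unfolding power2_eq_square[of "_ - _"] using a b r by (intro mult_mono) auto
    also have "\<dots> = norm (Gc z)" unfolding H by (simp add: norm_mult)
    finally show ?thesis using r by (simp add: field_simps)
  qed
  have "continuous_on (cball 0 2) H"
    using hol holomorphic_on_imp_continuous_on holomorphic_on_subset by blast
  then have "bounded (H ` cball 0 2)"
    by (intro compact_imp_bounded compact_continuous_image) auto
  then obtain M where M: "\<And>z. norm z \<le> 2 \<Longrightarrow> norm (H z) \<le> M" "M > 0"
    unfolding bounded_pos by (auto simp: cball_def)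
  have bound: "norm (H z) \<le> (M + 1) * exp (pi * norm z)" for z
  proof (cases "norm z \<le> 2")
    case True
    have "norm (H z) \<le> (M + 1) * 1" using M(1)[OF True] by simp
    also have "\<dots> \<le> (M + 1) * exp (pi * norm z)" using M(2) by (intro mult_left_mono) auto
    finally show ?thesis .
  next
    case False
    define r where "r = norm z"
    have r: "r > 2" using False by (simp add: r_def)
    have eq: "(r\<^sup>2 - 1)\<^sup>2 = (r + 1)\<^sup>2 * (r - 1)\<^sup>2" by (simp add: power2_eq_square algebra_simps)
    have "(r - 1)\<^sup>2 \<ge> 1" using r by (simp add: one_le_power)
    have "norm (H z) \<le> norm (Gc z) / (r\<^sup>2 - 1)\<^sup>2"
      using far[of z] False by (simp add: r_def)
    also have "\<dots> \<le> ((r + 1)\<^sup>2 * exp (pi * r)) / (r\<^sup>2 - 1)\<^sup>2"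
      using norm_Gc_le[of z] by (intro divide_right_mono) (auto simp: r_def)
    also have "\<dots> = exp (pi * r) / (r - 1)\<^sup>2"
      unfolding eq using r by simp
    also have "\<dots> \<le> exp (pi * r) / 1"
      using \<open>(r - 1)\<^sup>2 \<ge> 1\<close> by (intro divide_left_mono) auto
    also have "\<dots> \<le> (M + 1) * exp (pi * r)" using M(2) by simp
    finally show ?thesis by (simp add: r_def)
  qed
  have "exponential_type_le (\<lambda>z. c * H z) pi"
    unfolding exponential_type_le_def
  proof (intro allI impI exI)
    fix \<epsilon> :: real and z assume "\<epsilon> > 0"
    have "norm (c * H z) \<le> norm c * ((M + 1) * exp (pi * norm z))"
      unfolding norm_mult using bound by (intro mult_left_mono) auto
    also have "\<dots> \<le> norm c * ((M + 1) * exp ((pi + \<epsilon>) * norm z))"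
      using \<open>\<epsilon> > 0\<close> M(2) by (intro mult_left_mono) (auto intro!: mult_right_mono)
    finally show "norm (c * H z) \<le> norm c * (M + 1) * exp ((pi + \<epsilon>) * norm z)" by (simp add: mult_ac)
  qed
  moreover have "integrable lborel (\<lambda>x. c * H (of_real x))"
  proof (rule integrable_mult_right, rule Bochner_Integration.integrable_bound)
    show "integrable lborel (\<lambda>x::real. (8 + 5 * M) * inverse (1 + x\<^sup>2))"
      using integrable_inverse_1_plus_square
      by (intro integrable_mult_right) (simp add: einterval_eq set_integrable_def)
    have "continuous_on UNIV (\<lambda>x. H (complex_of_real x))"
      by (rule continuous_on_compose2[OF holomorphic_on_imp_continuous_on[OF hol]])
        (auto intro!: continuous_intros)
    then show "(\<lambda>x. H (complex_of_real x)) \<in> borel_measurable lborel"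
      by (simp add: borel_measurable_continuous_onI)
    have "norm (H (of_real x)) \<le> (8 + 5 * M) * inverse (1 + x\<^sup>2)" for x
    proof (cases "\<bar>x\<bar> \<le> 2")
      case True
      have "1 + x\<^sup>2 \<le> 5" using True power_mono[of "\<bar>x\<bar>" 2 2] by simp
      then have "1 \<le> 5 * inverse (1 + x\<^sup>2)" by (simp add: field_simps add_pos_nonneg)
      then have "M * 1 \<le> M * (5 * inverse (1 + x\<^sup>2))" using M(2) by (intro mult_left_mono) auto
      moreover have "norm (H (of_real x)) \<le> M" using M(1) True by simp
      ultimately show ?thesis by (simp add: distrib_right add_increasing)
    next
      case False
      define r where "r = \<bar>x\<bar>"
      have r: "r > 2" using False by (simp add: r_def)
      have r2: "x\<^sup>2 = r\<^sup>2" by (simp add: r_def)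
      have "\<bar>G x\<bar> \<le> \<bar>x\<^sup>2 - 1\<bar> * \<bar>cos (pi * x)\<bar> + 2 * \<bar>x\<bar> * \<bar>sin (pi * x)\<bar>"
        unfolding G_def using abs_triangle_ineq[of "(x\<^sup>2 - 1) * cos (pi * x)" "2 * x * sin (pi * x)"]
        by (simp add: abs_mult)
      also have "\<dots> \<le> \<bar>x\<^sup>2 - 1\<bar> + 2 * \<bar>x\<bar>"
        by (intro add_mono mult_left_le) auto
      also have "\<dots> \<le> (r + 1)\<^sup>2"
        unfolding r2 r_def[symmetric] using r by (auto simp: power2_eq_square algebra_simps abs_if)
      finally have "\<bar>G x\<bar> \<le> (r + 1)\<^sup>2" .
      moreover have "norm (H (of_real x)) \<le> \<bar>G x\<bar> / (r\<^sup>2 - 1)\<^sup>2"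
        using far[of "of_real x"] False by (simp add: Gc_of_real r_def)
      ultimately have "norm (H (of_real x)) \<le> (r + 1)\<^sup>2 / (r\<^sup>2 - 1)\<^sup>2"
        by (meson divide_right_mono order_trans zero_le_power2)
      also have "(r\<^sup>2 - 1)\<^sup>2 = (r + 1)\<^sup>2 * (r - 1)\<^sup>2" by (simp add: power2_eq_square algebra_simps)
      also have "(r + 1)\<^sup>2 / ((r + 1)\<^sup>2 * (r - 1)\<^sup>2) = 1 / (r - 1)\<^sup>2" using r by simp
      also have "1 / (r - 1)\<^sup>2 \<le> 8 * inverse (1 + x\<^sup>2)"
      proof -
        have "(2 * (r - 1))\<^sup>2 \<ge> r\<^sup>2" using r by (intro power_mono) auto
        moreover have "r\<^sup>2 \<ge> 1" using r by (simp add: one_le_power)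
        moreover have "(2 * (r - 1))\<^sup>2 = 4 * (r - 1)\<^sup>2" by (simp only: power_mult_distrib) simp
        ultimately have "1 + r\<^sup>2 \<le> 8 * (r - 1)\<^sup>2" by linarith
        then show ?thesis unfolding r2 using r by (simp add: field_simps add_pos_nonneg)
      qed
      also have "\<dots> \<le> (8 + 5 * M) * inverse (1 + x\<^sup>2)" using M(2) by (intro mult_right_mono) auto
      finally show ?thesis .
    qed
    then show "AE x in lborel. norm (H (of_real x)) \<le> norm ((8 + 5 * M) * inverse (1 + x\<^sup>2))"
      unfolding real_norm_def by (blast intro: AE_I2 order_trans[OF _ abs_ge_self])
  qed
  ultimately show ?thesis
    using hol by (auto simp: exp_type_L1_def intro!: holomorphic_intros)
qed

text \<open>
The extremal function is \<open>F x = amp y * G x / ((x\<^sup>2 - y\<^sup>2) (1 - x\<^sup>2))\<close>.  Outside \<open>[-1, 1]\<close> the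
  denominator is negative, so \<open>- F\<close> has the sign of \<open>G\<close>; inside, \<open>amp_G_le_quadratics\<close> says that
  \<open>F \<ge> 1\<close> where \<open>G < 0\<close> and \<open>F \<le> 1\<close> where \<open>G > 0\<close>.  Hence \<open>\<bar>chi - F\<bar> = (chi - F) sgn G\<close> almost
  everywhere, and the lower bound becomes an equality.
\<close>
lemma best_L1_attained:
  assumes y: "0 < y" "y < 1/2" "G y = 0"
  obtains F where "F \<in> exp_type_L1 pi" "(LINT x|lborel. norm (chi x - F (of_real x))) = 2 - 4 * y"
proof -
  obtain H where hol: "H holomorphic_on UNIV" and H: "\<And>z. Gc z = (z\<^sup>2 - (of_real y)\<^sup>2) * (z\<^sup>2 - 1) * H z"
    using Gc_divided[OF y] by blast
  define a where "a = amp y"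
  have a: "a > 0" unfolding a_def using y by (intro amp_pos)
  define F where "F = (\<lambda>z. - of_real a * H z)"
  have F: "F \<in> exp_type_L1 pi"
    unfolding F_def using y hol H by (intro divided_in_exp_type_L1)
  have eq: "of_real (norm (chi x - F (of_real x))) = (chi x - F (of_real x)) * of_real (sgn (G x))"
    if x: "x \<notin> {0, y, - y, 1, - 1}" for x
  proof -
    define p where "p = (x\<^sup>2 - y\<^sup>2) * (1 - x\<^sup>2)"
    have p0: "x\<^sup>2 - y\<^sup>2 \<noteq> 0" "1 - x\<^sup>2 \<noteq> 0" using x by (auto simp: power2_eq_iff power2_eq_1_iff)
    then have "p \<noteq> 0" by (simp add: p_def)
    have pc: "of_real p * H (of_real x) = - of_real (G x)"
      unfolding Gc_of_real[symmetric] H p_def by (simp add: algebra_simps)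
    have "of_real p * F (of_real x) = of_real (a * G x)"
      unfolding F_def using pc by (simp add: mult.left_commute)
    then have Fx: "F (of_real x) = of_real (a * G x / p)"
      using \<open>p \<noteq> 0\<close> by (simp add: field_simps)
    define d where "d = indicator {-1<..<1} x - a * G x / p"
    have diff: "chi x - F (of_real x) = of_real d"
      unfolding Fx d_def by (simp add: indicator_def)
    have "d * sgn (G x) = \<bar>d\<bar>"
    proof (cases "\<bar>x\<bar> < 1")
      case True
      have x2: "x\<^sup>2 < 1" using True by (simp add: abs_square_less_1)
      have le: "a * G x \<le> p" unfolding a_def p_def using amp_G_le_quadratics[OF y, of x] x True by auto
      have d: "d = 1 - a * G x / p" unfolding d_def using True by (auto simp: indicator_def)
      consider "\<bar>x\<bar> < y" | "y < \<bar>x\<bar>" using x by fastforce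
      then show ?thesis
      proof cases
        case 1
        then have "x\<^sup>2 < y\<^sup>2" using y abs_le_square_iff[of y x] by simp
        then have "p < 0" unfolding p_def using x2 by (intro mult_neg_pos) auto
        then have "d \<le> 0" using le by (simp add: d field_simps)
        moreover have "G x < 0" using G_sgn(1)[OF y 1] .
        ultimately show ?thesis by simp
      next
        case 2
        then have "y\<^sup>2 < x\<^sup>2" using y abs_le_square_iff[of x y] by simp
        then have "p > 0" unfolding p_def using x2 by (intro mult_pos_pos) auto
        then have "d \<ge> 0" using le by (simp add: d field_simps)
        moreover have "G x > 0" using G_sgn(2)[OF y 2] True by simp
        ultimately show ?thesis by simp
      qed
    next
      case False
      then have x1: "\<bar>x\<bar> > 1" using x by auto
      then have "x\<^sup>2 > 1" by (metis abs_square_le_1 not_le)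
      moreover have "y\<^sup>2 < 1" using y by (simp add: power_less_one_iff)
      ultimately have "p < 0" unfolding p_def by (intro mult_pos_neg) auto
      have "d = - a * G x / p" unfolding d_def using False by (auto simp: indicator_def)
      then have d: "d = (a / - p) * G x" by simp
      have "k * G x * sgn (G x) = \<bar>k * G x\<bar>" if "k > 0" for k
        using that by (simp add: sgn_if abs_mult)
      moreover have "a / - p > 0" using a \<open>p < 0\<close> by (intro divide_pos_pos) auto
      ultimately show ?thesis unfolding d .
    qed
    then show ?thesis unfolding diff norm_of_real by (metis of_real_mult)
  qed
  have meas_F: "(\<lambda>x. F (of_real x)) \<in> borel_measurable lborel"
    using integrable_exp_type_L1[OF F] by (rule borel_measurable_integrable)
  have "of_real (LINT x|lborel. norm (chi x - F (of_real x))) =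
      (LINT x|lborel. complex_of_real (norm (chi x - F (of_real x))))"
    by simp
  also have "\<dots> = (LINT x|lborel. (chi x - F (of_real x)) * of_real (sgn (G x)))"
  proof (rule integral_cong_AE)
    have "AE x in lborel. x \<notin> {0, y, - y, 1, - 1::real}"
      by (intro AE_not_in finite_imp_null_set_lborel) simp
    then show "AE x in lborel. complex_of_real (norm (chi x - F (of_real x))) = (chi x - F (of_real x)) * of_real (sgn (G x))"
      by eventually_elim (rule eq)
  qed (use meas_F in measurable)
  also have "\<dots> = of_real (2 - 4 * y)" by (rule integral_diff_sgn_G[OF F y])
  finally show thesis using that[OF F] of_real_eq_iff by blast
qed

theorem best_L1_approx_chi:
  assumes y: "0 < y" "y < 1/2" "G y = 0"
  shows "best_L1_approx pi chi = 2 - 4 * y"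
proof -
  obtain F where F: "F \<in> exp_type_L1 pi" "(LINT x|lborel. norm (chi x - F (of_real x))) = 2 - 4 * y"
    using best_L1_attained[OF y] .
  show ?thesis
    unfolding best_L1_approx_def
  proof (rule antisym)
    have "bdd_below ((\<lambda>F. LINT x|lborel. norm (chi x - F (complex_of_real x))) ` exp_type_L1 pi)"
      using best_L1_lower[OF _ y] by (intro bdd_belowI2)
    then show "(INF F\<in>exp_type_L1 pi. LINT x|lborel. norm (chi x - F (complex_of_real x))) \<le> 2 - 4 * y"
      using cINF_lower[OF _ F(1)] F(2) by fastforce
    show "2 - 4 * y \<le> (INF F\<in>exp_type_L1 pi. LINT x|lborel. norm (chi x - F (complex_of_real x)))"
      using F(1) best_L1_lower[OF _ y] by (intro cINF_greatest) auto
  qed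
qed

section \<open>The transcendental equation\<close>

text \<open>
\<open>G (v / pi) = 0\<close> reads \<open>tan v = (pi\<^sup>2 - v\<^sup>2) / (2 pi v)\<close>.  Since \<open>(2 pi v)\<^sup>2 + (pi\<^sup>2 - v\<^sup>2)\<^sup>2 = (v\<^sup>2 + pi\<^sup>2)\<^sup>2\<close>,
  this is the same as prescribing \<open>cos v\<close>.
\<close>
lemma root_equation_iff_G:
  assumes v: "0 < v" "v < pi / 2"
  shows "cos v = 2 * pi * v / (v\<^sup>2 + pi\<^sup>2) \<longleftrightarrow> G (v / pi) = 0"
proof -
  define c s where "c = cos v" and "s = sin v"
  have s: "s > 0" and c: "c > 0"
    using v pi_gt_zero by (auto simp: s_def c_def intro!: sin_gt_zero cos_gt_zero)
  have cs: "s\<^sup>2 = 1 - c\<^sup>2" by (simp add: c_def s_def sin_squared_eq)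
  have vp: "v\<^sup>2 < pi\<^sup>2" using v by (intro power_strict_mono) auto
  have N: "v\<^sup>2 + pi\<^sup>2 > 0" using v by (simp add: add_pos_pos)
  have "G (v / pi) = ((v\<^sup>2 - pi\<^sup>2) * c + 2 * pi * v * s) / pi\<^sup>2"
    by (simp add: G_def c_def s_def field_simps power2_eq_square)
  then have G0: "G (v / pi) = 0 \<longleftrightarrow> 2 * pi * v * s = (pi\<^sup>2 - v\<^sup>2) * c"
    by (simp add: algebra_simps)
  have pyth: "(2 * pi * v)\<^sup>2 + (pi\<^sup>2 - v\<^sup>2)\<^sup>2 = (v\<^sup>2 + pi\<^sup>2)\<^sup>2"
    by (simp add: power2_eq_square algebra_simps)
  have "cos v = 2 * pi * v / (v\<^sup>2 + pi\<^sup>2) \<longleftrightarrow> (v\<^sup>2 + pi\<^sup>2) * c = 2 * pi * v"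
    using N by (auto simp: c_def field_simps)
  also have "\<dots> \<longleftrightarrow> ((v\<^sup>2 + pi\<^sup>2) * c)\<^sup>2 = (2 * pi * v)\<^sup>2"
    using N c v by (simp add: power2_eq_iff_nonneg)
  also have "\<dots> \<longleftrightarrow> (2 * pi * v * s)\<^sup>2 = ((pi\<^sup>2 - v\<^sup>2) * c)\<^sup>2"
  proof -
    have "(2 * pi * v * s)\<^sup>2 - ((pi\<^sup>2 - v\<^sup>2) * c)\<^sup>2 = (2 * pi * v)\<^sup>2 * (1 - c\<^sup>2) - (pi\<^sup>2 - v\<^sup>2)\<^sup>2 * c\<^sup>2"
      by (simp add: power_mult_distrib cs)
    also have "\<dots> = (2 * pi * v)\<^sup>2 - ((2 * pi * v)\<^sup>2 + (pi\<^sup>2 - v\<^sup>2)\<^sup>2) * c\<^sup>2"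
      by (simp add: algebra_simps)
    also have "\<dots> = (2 * pi * v)\<^sup>2 - ((v\<^sup>2 + pi\<^sup>2) * c)\<^sup>2"
      unfolding pyth by (simp add: power_mult_distrib)
    finally show ?thesis by linarith
  qed
  also have "\<dots> \<longleftrightarrow> 2 * pi * v * s = (pi\<^sup>2 - v\<^sup>2) * c"
    using s c v vp by (intro power2_eq_iff_nonneg) auto
  finally show ?thesis using G0 by simp
qed

lemma ex1_G_root: "\<exists>!y. 0 < y \<and> y < 1/2 \<and> G y = 0"
proof -
  have "G 0 = - 1" "G (1/2) = 1" by (simp_all add: G_def)
  moreover have "continuous_on {0..1/2} G" unfolding G_def[abs_def] by (intro continuous_intros)
  ultimately obtain y where y: "0 \<le> y" "y \<le> 1/2" "G y = 0"
    using IVT'[of G 0 0 "1/2"] by auto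
  have "y \<noteq> 0" "y \<noteq> 1/2"
    using y(3) \<open>G 0 = - 1\<close> \<open>G (1/2) = 1\<close> zero_neq_one neg_equal_0_iff_equal by metis+
  show ?thesis
  proof (rule ex1I[of _ y])
    show "0 < y \<and> y < 1/2 \<and> G y = 0" using y \<open>y \<noteq> 0\<close> \<open>y \<noteq> 1/2\<close> by simp
    show "z = y" if "0 < z \<and> z < 1/2 \<and> G z = 0" for z
      using that y G_strict_mono[of z y] G_strict_mono[of y z] by (cases z y rule: linorder_cases) auto
  qed
qed

theorem mainTheorem3:
  shows "(\<exists>!v::real. 0 < v \<and> v < pi / 2 \<and> cos v = 2 * pi * v / (v\<^sup>2 + pi\<^sup>2)) \<and>
    (\<forall>v\<^sub>0::real. 0 < v\<^sub>0 \<and> v\<^sub>0 < pi / 2 \<and> cos v\<^sub>0 = 2 * pi * v\<^sub>0 / (v\<^sub>0\<^sup>2 + pi\<^sup>2) \<longrightarrow>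
      best_L1_approx pi (indicator {-1<..<1}) = 2 - 4 * v\<^sub>0 / pi)"
proof
  have root: "0 < v \<and> v < pi / 2 \<and> cos v = 2 * pi * v / (v\<^sup>2 + pi\<^sup>2) \<longleftrightarrow>
      0 < v / pi \<and> v / pi < 1/2 \<and> G (v / pi) = 0" for v
    using root_equation_iff_G[of v] by (auto simp: field_simps)
  obtain y where y: "0 < y" "y < 1/2" "G y = 0" and uniq: "\<And>z. 0 < z \<and> z < 1/2 \<and> G z = 0 \<Longrightarrow> z = y"
    using ex1_G_root by auto
  show "\<exists>!v::real. 0 < v \<and> v < pi / 2 \<and> cos v = 2 * pi * v / (v\<^sup>2 + pi\<^sup>2)"
    unfolding root
  proof (rule ex1I[of _ "pi * y"])
    show "0 < pi * y / pi \<and> pi * y / pi < 1/2 \<and> G (pi * y / pi) = 0" using y by simp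
    show "v = pi * y" if "0 < v / pi \<and> v / pi < 1/2 \<and> G (v / pi) = 0" for v
      using uniq[OF that] by (simp add: field_simps)
  qed
  show "\<forall>v\<^sub>0::real. 0 < v\<^sub>0 \<and> v\<^sub>0 < pi / 2 \<and> cos v\<^sub>0 = 2 * pi * v\<^sub>0 / (v\<^sub>0\<^sup>2 + pi\<^sup>2) \<longrightarrow>
      best_L1_approx pi (indicator {-1<..<1}) = 2 - 4 * v\<^sub>0 / pi"
    unfolding root using best_L1_approx_chi by auto
qed

end
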